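(* Let $G$ be a finite $2$-group, let $H$ be a subgroup of index $2$ in $G$, and let $g\in G\setminus H$. Let $\bar f\in Z^2(H,\mu_2)$ be a $2$-cocycle corresponding to a group extension $$1\longrightarrow \mu_2=\{\pm1\}\longrightarrow H_2\xrightarrow{\ \beta\ } H\longrightarrow 1,$$ and let $f\in Z^2(G,\mu_2)$ be a $2$-cocycle corresponding to a group extension $$1\longrightarrow \mu_2=\{\pm1\}\longrightarrow G_1\xrightarrow{\ \alpha\ } G\longrightarrow 1,$$ such that $[f]=\mathrm{cor}_{G/H}([\bar f])$ in $H^2(G,\mu_2)$. Put $H_1=\alpha^{-1}(H)$. Then the following conditions hold: (1) $\exp(H_1)\leq\exp(H_2)$. (2) If every $h\in H$ with $\mathrm{ord}(h)=\exp(H)$ satisfies $ghg^{-1}\in\langle h\rangle$, then $\exp(H_1)=\exp(H)$.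
   Context: $\mu_2=\{\pm1\}$ is a trivial module for all groups involved. $\mathrm{ord}(x)$ denotes the order of an element and $\exp(X)$ the exponent of a finite group $X$ (the least common multiple of the orders of its elements). $[f]$ denotes the class in $H^2$ of a $2$-cocycle $f$; a cocycle corresponds to an extension if its class is the class of that extension. $\mathrm{cor}_{G/H}:H^2(H,\mu_2)\to H^2(G,\mu_2)$ is the usual corestriction (transfer) homomorphism in group cohomology.
   Formalization: Part (2) is stated for nontrivial H; as printed it fails for H = 1 (|G| = 2), where the condition holds, exp(H) = 1, but H_1 = μ_2 has exponent 2. *)

theory Defs
  imports "HOL-Algebra.Algebra"
begin

section \<open>Second cohomology with trivial coefficients\<close>

text \<open>Throughout, \<open>A\<close> is an abelian group, written multiplicatively, on which all groups act
  trivially. Cochains are not assumed to be normalized. They are extensional functions, so that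
  equality of cochains is equality on the group.\<close>

definition cochains2 ::
  "('a, 'm) monoid_scheme \<Rightarrow> ('c, 'n) monoid_scheme \<Rightarrow> ('a \<times> 'a \<Rightarrow> 'c) monoid"
  where "cochains2 G A = product_group (carrier G \<times> carrier G) (\<lambda>_. A)"

definition Z2 :: "('a, 'm) monoid_scheme \<Rightarrow> ('c, 'n) monoid_scheme \<Rightarrow> ('a \<times> 'a \<Rightarrow> 'c) set"
  where "Z2 G A = {f \<in> carrier (cochains2 G A).
    \<forall>x\<in>carrier G. \<forall>y\<in>carrier G. \<forall>z\<in>carrier G.
      f (y, z) \<otimes>\<^bsub>A\<^esub> f (x, y \<otimes>\<^bsub>G\<^esub> z) = f (x \<otimes>\<^bsub>G\<^esub> y, z) \<otimes>\<^bsub>A\<^esub> f (x, y)}"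

definition coboundary ::
  "('a, 'm) monoid_scheme \<Rightarrow> ('c, 'n) monoid_scheme \<Rightarrow> ('a \<Rightarrow> 'c) \<Rightarrow> 'a \<times> 'a \<Rightarrow> 'c"
  where "coboundary G A u = (\<lambda>(x, y) \<in> carrier G \<times> carrier G.
    u x \<otimes>\<^bsub>A\<^esub> u y \<otimes>\<^bsub>A\<^esub> inv\<^bsub>A\<^esub> (u (x \<otimes>\<^bsub>G\<^esub> y)))"

definition B2 :: "('a, 'm) monoid_scheme \<Rightarrow> ('c, 'n) monoid_scheme \<Rightarrow> ('a \<times> 'a \<Rightarrow> 'c) set"
  where "B2 G A = coboundary G A ` (carrier G \<rightarrow> carrier A)"

definition cocycles2 ::
  "('a, 'm) monoid_scheme \<Rightarrow> ('c, 'n) monoid_scheme \<Rightarrow> ('a \<times> 'a \<Rightarrow> 'c) monoid"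
  where "cocycles2 G A = (cochains2 G A)\<lparr>carrier := Z2 G A\<rparr>"

definition cohomology2 ::
  "('a, 'm) monoid_scheme \<Rightarrow> ('c, 'n) monoid_scheme \<Rightarrow> ('a \<times> 'a \<Rightarrow> 'c) set monoid"
  where "cohomology2 G A = cocycles2 G A Mod B2 G A"

definition cohomology_class ::
  "('a, 'm) monoid_scheme \<Rightarrow> ('c, 'n) monoid_scheme \<Rightarrow> ('a \<times> 'a \<Rightarrow> 'c) \<Rightarrow> ('a \<times> 'a \<Rightarrow> 'c) set"
  where "cohomology_class G A f = B2 G A #>\<^bsub>cocycles2 G A\<^esub> f"


section \<open>Corestriction\<close>

definition transversal :: "('a, 'm) monoid_scheme \<Rightarrow> 'a set \<Rightarrow> ('a set \<Rightarrow> 'a) \<Rightarrow> bool"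
  where "transversal G H t \<longleftrightarrow> (\<forall>C\<in>rcosets\<^bsub>G\<^esub> H. t C \<in> C)"

definition coset_factor ::
  "('a, 'm) monoid_scheme \<Rightarrow> 'a set \<Rightarrow> ('a set \<Rightarrow> 'a) \<Rightarrow> 'a set \<Rightarrow> 'a \<Rightarrow> 'a"
  where "coset_factor G H t C x = t C \<otimes>\<^bsub>G\<^esub> x \<otimes>\<^bsub>G\<^esub> inv\<^bsub>G\<^esub> (t (C #>\<^bsub>G\<^esub> x))"

text \<open>On homogeneous cochains the corestriction is
    \<open>\<phi> \<mapsto> (\<lambda>(x0, x1, x2). \<Prod>C. \<phi> (t C x0 t(C x0)\<inverse>, t C x1 t(C x1)\<inverse>, t C x2 t(C x2)\<inverse>))\<close>,
  the product being over the right cosets of \<open>H\<close>; this is the transfer over the coset space applied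
  to the pullback of \<open>\<phi>\<close> along the \<open>H\<close>-map \<open>x \<mapsto> x t(H x)\<inverse>\<close> from \<open>G\<close> to \<open>H\<close>. The formula below
  is its translation to inhomogeneous cochains \<open>f (x, y) = \<phi> (\<one>, x, x y)\<close>.\<close>

definition corestriction_cochain ::
  "('a, 'm) monoid_scheme \<Rightarrow> ('c, 'n) monoid_scheme \<Rightarrow> 'a set \<Rightarrow> ('a set \<Rightarrow> 'a) \<Rightarrow>
    ('a \<times> 'a \<Rightarrow> 'c) \<Rightarrow> 'a \<times> 'a \<Rightarrow> 'c"
  where "corestriction_cochain G A H t f = (\<lambda>(x, y) \<in> carrier G \<times> carrier G.
    \<Otimes>\<^bsub>A\<^esub>C\<in>rcosets\<^bsub>G\<^esub> H. f (coset_factor G H t C x, coset_factor G H t (C #>\<^bsub>G\<^esub> x) y))"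

text \<open>The induced map from \<open>H\<^sup>2(H, A)\<close> to \<open>H\<^sup>2(G, A)\<close>. Lemma \<open>corestriction_class\<close>
  below shows that it depends neither on the representing cocycle nor on the transversal.\<close>

definition corestriction ::
  "('a, 'm) monoid_scheme \<Rightarrow> ('c, 'n) monoid_scheme \<Rightarrow> 'a set \<Rightarrow>
    ('a \<times> 'a \<Rightarrow> 'c) set \<Rightarrow> ('a \<times> 'a \<Rightarrow> 'c) set"
  where "corestriction G A H \<xi> =
    the_elem ((\<lambda>f. cohomology_class G A
      (corestriction_cochain G A H (\<lambda>C. SOME x. x \<in> C) f)) ` \<xi>)"


section \<open>Central extensions and their classes\<close>

text \<open>\<open>1 \<rightarrow> A \<rightarrow> E \<rightarrow> G \<rightarrow> 1\<close> with maps \<open>\<iota>\<close> and \<open>\<pi>\<close>, inducing the trivial action of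
  \<open>G\<close> on \<open>A\<close>.\<close>

definition central_extension ::
  "('c, 'n) monoid_scheme \<Rightarrow> ('c \<Rightarrow> 'e) \<Rightarrow> ('e, 'k) monoid_scheme \<Rightarrow> ('e \<Rightarrow> 'a) \<Rightarrow>
    ('a, 'm) monoid_scheme \<Rightarrow> bool"
  where "central_extension A \<iota> E \<pi> G \<longleftrightarrow>
    group E \<and> \<iota> \<in> mon A E \<and> \<pi> \<in> epi E G \<and> \<iota> ` carrier A = kernel E G \<pi> \<and>
    (\<forall>a\<in>carrier A. \<forall>e\<in>carrier E. \<iota> a \<otimes>\<^bsub>E\<^esub> e = e \<otimes>\<^bsub>E\<^esub> \<iota> a)"

text \<open>The cocycle \<open>f\<close> of a section \<open>s\<close>, determined by \<open>s x s y = \<iota> (f (x, y)) s (x y)\<close>.\<close>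

definition section_cocycle ::
  "('c, 'n) monoid_scheme \<Rightarrow> ('c \<Rightarrow> 'e) \<Rightarrow> ('e, 'k) monoid_scheme \<Rightarrow>
    ('a, 'm) monoid_scheme \<Rightarrow> ('a \<Rightarrow> 'e) \<Rightarrow> 'a \<times> 'a \<Rightarrow> 'c"
  where "section_cocycle A \<iota> E G s = (\<lambda>(x, y) \<in> carrier G \<times> carrier G.
    inv_into (carrier A) \<iota> (s x \<otimes>\<^bsub>E\<^esub> s y \<otimes>\<^bsub>E\<^esub> inv\<^bsub>E\<^esub> (s (x \<otimes>\<^bsub>G\<^esub> y))))"

text \<open>The section \<open>inv_into (carrier E) \<pi>\<close> is an arbitrary choice; see \<open>extension_class_eq\<close>.\<close>

definition extension_class ::
  "('c, 'n) monoid_scheme \<Rightarrow> ('c \<Rightarrow> 'e) \<Rightarrow> ('e, 'k) monoid_scheme \<Rightarrow> ('e \<Rightarrow> 'a) \<Rightarrow>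
    ('a, 'm) monoid_scheme \<Rightarrow> ('a \<times> 'a \<Rightarrow> 'c) set"
  where "extension_class A \<iota> E \<pi> G =
    cohomology_class G A (section_cocycle A \<iota> E G (inv_into (carrier E) \<pi>))"

definition cocycle_of_extension ::
  "('a \<times> 'a \<Rightarrow> 'c) \<Rightarrow> ('c, 'n) monoid_scheme \<Rightarrow> ('c \<Rightarrow> 'e) \<Rightarrow> ('e, 'k) monoid_scheme \<Rightarrow>
    ('e \<Rightarrow> 'a) \<Rightarrow> ('a, 'm) monoid_scheme \<Rightarrow> bool"
  where "cocycle_of_extension f A \<iota> E \<pi> G \<longleftrightarrow>
    f \<in> Z2 G A \<and> central_extension A \<iota> E \<pi> G \<and>
    cohomology_class G A f = extension_class A \<iota> E \<pi> G"


section \<open>The group of signs and exponents\<close>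

definition mu2 :: "int monoid"
  where "mu2 = \<lparr>carrier = {1, -1}, monoid.mult = (*), one = 1\<rparr>"

text \<open>Intended for finite groups only; then the set of orders is finite and the orders are
  positive.\<close>

definition group_exponent :: "('a, 'm) monoid_scheme \<Rightarrow> nat"
  where "group_exponent G = (LCM x\<in>carrier G. group.ord G x)"


section \<open>Well-definedness\<close>

lemma comm_group_mu2: "comm_group mu2"
  by (rule comm_groupI) (auto simp: mu2_def)

lemma Z2_closed:
  assumes "f \<in> Z2 G A" "x \<in> carrier G" "y \<in> carrier G"
  shows "f (x, y) \<in> carrier A"
  using assms by (auto simp: Z2_def cochains2_def PiE_iff)

lemma Z2_cocycle:
  assumes "f \<in> Z2 G A" "x \<in> carrier G" "y \<in> carrier G" "z \<in> carrier G"
  shows "f (y, z) \<otimes>\<^bsub>A\<^esub> f (x, y \<otimes>\<^bsub>G\<^esub> z) = f (x \<otimes>\<^bsub>G\<^esub> y, z) \<otimes>\<^bsub>A\<^esub> f (x, y)"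
  using assms by (auto simp: Z2_def)

lemma Z2_I:
  assumes "\<And>x y. x \<in> carrier G \<Longrightarrow> y \<in> carrier G \<Longrightarrow> f x y \<in> carrier A"
    and "\<And>x y z. x \<in> carrier G \<Longrightarrow> y \<in> carrier G \<Longrightarrow> z \<in> carrier G \<Longrightarrow>
      f y z \<otimes>\<^bsub>A\<^esub> f x (y \<otimes>\<^bsub>G\<^esub> z) = f (x \<otimes>\<^bsub>G\<^esub> y) z \<otimes>\<^bsub>A\<^esub> f x y"
    and "group G"
  shows "(\<lambda>(x, y) \<in> carrier G \<times> carrier G. f x y) \<in> Z2 G A"
proof -
  interpret group G by fact
  show ?thesis using assms(1,2) by (auto simp: Z2_def cochains2_def)
qed

context
  fixes G :: "('a, 'm) monoid_scheme" and A :: "('c, 'n) monoid_scheme"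
  assumes G: "group G" and A: "comm_group A"
begin

interpretation G: group G by (rule G)
interpretation A: comm_group A by (rule A)

lemma subgroup_Z2: "subgroup (Z2 G A) (cochains2 G A)"
proof
  show "Z2 G A \<subseteq> carrier (cochains2 G A)" by (auto simp: Z2_def)
  show "\<one>\<^bsub>cochains2 G A\<^esub> \<in> Z2 G A" by (auto simp: Z2_def cochains2_def)
next
  fix f g assume f: "f \<in> Z2 G A" and g: "g \<in> Z2 G A"
  have "(\<lambda>(x, y)\<in>carrier G \<times> carrier G. f (x, y) \<otimes>\<^bsub>A\<^esub> g (x, y)) \<in> Z2 G A"
  proof (rule Z2_I[OF _ _ G])
    fix x y z assume xyz: "x \<in> carrier G" "y \<in> carrier G" "z \<in> carrier G"
    note c = Z2_closed[OF f] Z2_closed[OF g] Z2_cocycle[OF f xyz] Z2_cocycle[OF g xyz]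
    have "f (y, z) \<otimes>\<^bsub>A\<^esub> g (y, z) \<otimes>\<^bsub>A\<^esub> (f (x, y \<otimes>\<^bsub>G\<^esub> z) \<otimes>\<^bsub>A\<^esub> g (x, y \<otimes>\<^bsub>G\<^esub> z))
       = (f (y, z) \<otimes>\<^bsub>A\<^esub> f (x, y \<otimes>\<^bsub>G\<^esub> z)) \<otimes>\<^bsub>A\<^esub> (g (y, z) \<otimes>\<^bsub>A\<^esub> g (x, y \<otimes>\<^bsub>G\<^esub> z))"
      using c(1,2) xyz by (simp add: A.m_ac)
    also have "\<dots> = (f (x \<otimes>\<^bsub>G\<^esub> y, z) \<otimes>\<^bsub>A\<^esub> f (x, y)) \<otimes>\<^bsub>A\<^esub> (g (x \<otimes>\<^bsub>G\<^esub> y, z) \<otimes>\<^bsub>A\<^esub> g (x, y))"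
      by (simp add: c(3,4))
    finally show "f (y, z) \<otimes>\<^bsub>A\<^esub> g (y, z) \<otimes>\<^bsub>A\<^esub> (f (x, y \<otimes>\<^bsub>G\<^esub> z) \<otimes>\<^bsub>A\<^esub> g (x, y \<otimes>\<^bsub>G\<^esub> z))
       = f (x \<otimes>\<^bsub>G\<^esub> y, z) \<otimes>\<^bsub>A\<^esub> g (x \<otimes>\<^bsub>G\<^esub> y, z) \<otimes>\<^bsub>A\<^esub> (f (x, y) \<otimes>\<^bsub>A\<^esub> g (x, y))"
      using c(1,2) xyz by (simp add: A.m_ac)
  qed (use Z2_closed[OF f] Z2_closed[OF g] in auto)
  moreover have "f \<otimes>\<^bsub>cochains2 G A\<^esub> g
      = (\<lambda>(x, y)\<in>carrier G \<times> carrier G. f (x, y) \<otimes>\<^bsub>A\<^esub> g (x, y))"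
    by (auto simp: cochains2_def)
  ultimately show "f \<otimes>\<^bsub>cochains2 G A\<^esub> g \<in> Z2 G A" by simp
next
  fix f assume f: "f \<in> Z2 G A"
  have "(\<lambda>(x, y)\<in>carrier G \<times> carrier G. inv\<^bsub>A\<^esub> f (x, y)) \<in> Z2 G A"
  proof (rule Z2_I[OF _ _ G])
    fix x y z assume xyz: "x \<in> carrier G" "y \<in> carrier G" "z \<in> carrier G"
    show "inv\<^bsub>A\<^esub> f (y, z) \<otimes>\<^bsub>A\<^esub> inv\<^bsub>A\<^esub> f (x, y \<otimes>\<^bsub>G\<^esub> z) = inv\<^bsub>A\<^esub> f (x \<otimes>\<^bsub>G\<^esub> y, z) \<otimes>\<^bsub>A\<^esub> inv\<^bsub>A\<^esub> f (x, y)"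
      using Z2_closed[OF f] Z2_cocycle[OF f xyz] xyz by (simp flip: A.inv_mult)
  qed (use Z2_closed[OF f] in auto)
  moreover have "inv\<^bsub>cochains2 G A\<^esub> f = (\<lambda>(x, y)\<in>carrier G \<times> carrier G. inv\<^bsub>A\<^esub> f (x, y))"
    using f A.group_axioms by (auto simp: cochains2_def Z2_def)
  ultimately show "inv\<^bsub>cochains2 G A\<^esub> f \<in> Z2 G A" by simp
qed

lemma group_cochains2: "group (cochains2 G A)"
  by (simp add: cochains2_def A.group_axioms)

lemma comm_group_cocycles2: "comm_group (cocycles2 G A)"
proof -
  have grp: "group (cocycles2 G A)"
    unfolding cocycles2_def
    using group.subgroup_imp_group[OF group_cochains2 subgroup_Z2] .
  show ?thesis
    by (rule group.group_comm_groupI[OF grp])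
       (auto simp: cocycles2_def cochains2_def A.m_comm Z2_closed intro!: restrict_ext)
qed

lemma coboundary_Z2:
  assumes u: "u \<in> carrier G \<rightarrow> carrier A" shows "coboundary G A u \<in> Z2 G A"
  unfolding coboundary_def
proof (rule Z2_I[OF _ _ G])
  fix x y z assume xyz: "x \<in> carrier G" "y \<in> carrier G" "z \<in> carrier G"
  have [simp]: "u v \<in> carrier A" if "v \<in> carrier G" for v using u that by auto
  have 1: "inv\<^bsub>A\<^esub> b \<otimes>\<^bsub>A\<^esub> (b \<otimes>\<^bsub>A\<^esub> c) = c" if "b \<in> carrier A" "c \<in> carrier A" for b c
    using that by (simp flip: A.m_assoc)
  have 2: "b \<otimes>\<^bsub>A\<^esub> (inv\<^bsub>A\<^esub> b \<otimes>\<^bsub>A\<^esub> c) = c" if "b \<in> carrier A" "c \<in> carrier A" for b c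
    using that by (simp flip: A.m_assoc)
  show "u y \<otimes>\<^bsub>A\<^esub> u z \<otimes>\<^bsub>A\<^esub> inv\<^bsub>A\<^esub> u (y \<otimes>\<^bsub>G\<^esub> z) \<otimes>\<^bsub>A\<^esub> (u x \<otimes>\<^bsub>A\<^esub> u (y \<otimes>\<^bsub>G\<^esub> z) \<otimes>\<^bsub>A\<^esub> inv\<^bsub>A\<^esub> u (x \<otimes>\<^bsub>G\<^esub> (y \<otimes>\<^bsub>G\<^esub> z))) =
    u (x \<otimes>\<^bsub>G\<^esub> y) \<otimes>\<^bsub>A\<^esub> u z \<otimes>\<^bsub>A\<^esub> inv\<^bsub>A\<^esub> u (x \<otimes>\<^bsub>G\<^esub> y \<otimes>\<^bsub>G\<^esub> z) \<otimes>\<^bsub>A\<^esub> (u x \<otimes>\<^bsub>A\<^esub> u y \<otimes>\<^bsub>A\<^esub> inv\<^bsub>A\<^esub> u (x \<otimes>\<^bsub>G\<^esub> y))"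
    (is "?l = ?r")
  proof -
    have "?l = u x \<otimes>\<^bsub>A\<^esub> (u y \<otimes>\<^bsub>A\<^esub> (u z \<otimes>\<^bsub>A\<^esub> inv\<^bsub>A\<^esub> u (x \<otimes>\<^bsub>G\<^esub> (y \<otimes>\<^bsub>G\<^esub> z)))) \<otimes>\<^bsub>A\<^esub> (u (y \<otimes>\<^bsub>G\<^esub> z) \<otimes>\<^bsub>A\<^esub> inv\<^bsub>A\<^esub> u (y \<otimes>\<^bsub>G\<^esub> z))"
      using xyz by (simp add: A.m_ac 1 2)
    moreover have "?r = u x \<otimes>\<^bsub>A\<^esub> (u y \<otimes>\<^bsub>A\<^esub> (u z \<otimes>\<^bsub>A\<^esub> inv\<^bsub>A\<^esub> u (x \<otimes>\<^bsub>G\<^esub> (y \<otimes>\<^bsub>G\<^esub> z)))) \<otimes>\<^bsub>A\<^esub> (u (x \<otimes>\<^bsub>G\<^esub> y) \<otimes>\<^bsub>A\<^esub> inv\<^bsub>A\<^esub> u (x \<otimes>\<^bsub>G\<^esub> y))"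
      using xyz by (simp add: A.m_ac G.m_assoc 1 2)
    ultimately show ?thesis using xyz by simp
  qed
qed (use u in auto)

lemma B2_subset_Z2: "B2 G A \<subseteq> Z2 G A"
  using coboundary_Z2 by (auto simp: B2_def)

lemma subgroup_B2: "subgroup (B2 G A) (cocycles2 G A)"
proof (rule group.subgroupI)
  interpret Z: comm_group "cocycles2 G A" by (rule comm_group_cocycles2)
  show "group (cocycles2 G A)" by (rule Z.group_axioms)
  show "B2 G A \<subseteq> carrier (cocycles2 G A)" using B2_subset_Z2 by (simp add: cocycles2_def)
  show "B2 G A \<noteq> {}" using A.one_closed by (auto simp: B2_def)
  have mult: "coboundary G A u \<otimes>\<^bsub>cocycles2 G A\<^esub> coboundary G A v
      = coboundary G A (\<lambda>x. u x \<otimes>\<^bsub>A\<^esub> v x)"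
    if "u \<in> carrier G \<rightarrow> carrier A" "v \<in> carrier G \<rightarrow> carrier A" for u v
    using that
    by (auto simp: cocycles2_def cochains2_def coboundary_def Pi_iff A.inv_mult A.m_ac intro!: restrict_ext)
  show "a \<otimes>\<^bsub>cocycles2 G A\<^esub> b \<in> B2 G A" if "a \<in> B2 G A" "b \<in> B2 G A" for a b
    using that by (fastforce simp: B2_def mult Pi_iff)
  have one: "coboundary G A (\<lambda>_. \<one>\<^bsub>A\<^esub>) = \<one>\<^bsub>cocycles2 G A\<^esub>"
    by (auto simp: cocycles2_def cochains2_def coboundary_def intro!: restrict_ext)
  show "inv\<^bsub>cocycles2 G A\<^esub> a \<in> B2 G A" if a: "a \<in> B2 G A" for a
  proof -
    obtain u where u: "u \<in> carrier G \<rightarrow> carrier A" "a = coboundary G A u"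
      using a by (auto simp: B2_def)
    let ?v = "\<lambda>x. inv\<^bsub>A\<^esub> u x"
    have v: "?v \<in> carrier G \<rightarrow> carrier A" using u by auto
    have "coboundary G A ?v \<otimes>\<^bsub>cocycles2 G A\<^esub> a = coboundary G A (\<lambda>x. ?v x \<otimes>\<^bsub>A\<^esub> u x)"
      using mult[OF v u(1)] u(2) by simp
    also have "\<dots> = coboundary G A (\<lambda>_. \<one>\<^bsub>A\<^esub>)"
      using u(1) by (auto simp: coboundary_def Pi_iff A.l_inv intro!: restrict_ext)
    finally have "inv\<^bsub>cocycles2 G A\<^esub> a = coboundary G A ?v"
      using one coboundary_Z2[OF v] coboundary_Z2[OF u(1)] u(2)
      by (intro Z.inv_equality) (auto simp: cocycles2_def)
    then show ?thesis using v by (auto simp: B2_def)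
  qed
qed

lemma comm_group_cohomology2: "comm_group (cohomology2 G A)"
  unfolding cohomology2_def
  by (rule comm_group.abelian_FactGroup[OF comm_group_cocycles2 subgroup_B2])

lemma cohomology_class_self: "f \<in> Z2 G A \<Longrightarrow> f \<in> cohomology_class G A f"
  unfolding cohomology_class_def
  using group.rcos_self[OF comm_group.axioms(2)[OF comm_group_cocycles2] _ subgroup_B2]
  by (simp add: cocycles2_def)

lemma cohomology_class_eqI:
  assumes f: "f \<in> Z2 G A" and f': "f' \<in> Z2 G A" and u: "u \<in> carrier G \<rightarrow> carrier A"
    and eq: "\<And>x y. x \<in> carrier G \<Longrightarrow> y \<in> carrier G \<Longrightarrow>
      f' (x, y) \<otimes>\<^bsub>A\<^esub> u (x \<otimes>\<^bsub>G\<^esub> y) = f (x, y) \<otimes>\<^bsub>A\<^esub> u x \<otimes>\<^bsub>A\<^esub> u y"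
  shows "cohomology_class G A f' = cohomology_class G A f"
proof -
  interpret Z: comm_group "cocycles2 G A" by (rule comm_group_cocycles2)
  have "f' (x, y) = u x \<otimes>\<^bsub>A\<^esub> u y \<otimes>\<^bsub>A\<^esub> inv\<^bsub>A\<^esub> u (x \<otimes>\<^bsub>G\<^esub> y) \<otimes>\<^bsub>A\<^esub> f (x, y)"
    if xy: "x \<in> carrier G" "y \<in> carrier G" for x y
  proof -
    have [simp]: "u v \<in> carrier A" if "v \<in> carrier G" for v using u that by auto
    have "f' (x, y) = f (x, y) \<otimes>\<^bsub>A\<^esub> u x \<otimes>\<^bsub>A\<^esub> u y \<otimes>\<^bsub>A\<^esub> inv\<^bsub>A\<^esub> u (x \<otimes>\<^bsub>G\<^esub> y)"
      using eq[OF xy] xy Z2_closed[OF f] Z2_closed[OF f'] by (intro A.inv_solve_right[THEN iffD2]) auto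
    then show ?thesis using xy Z2_closed[OF f] by (simp add: A.m_ac)
  qed
  then have "f' = coboundary G A u \<otimes>\<^bsub>cocycles2 G A\<^esub> f"
    using f' by (auto simp: cocycles2_def cochains2_def coboundary_def Z2_def PiE_iff extensional_def
        restrict_def fun_eq_iff)
  then have "f' \<in> B2 G A #>\<^bsub>cocycles2 G A\<^esub> f"
    using u by (auto simp: r_coset_def B2_def)
  then show ?thesis
    unfolding cohomology_class_def
    using Z.repr_independence[OF _ _ subgroup_B2] f by (simp add: cocycles2_def)
qed

lemma cohomology_class_memD:
  assumes f: "f \<in> Z2 G A" and f': "f' \<in> cohomology_class G A f"
  obtains u where "f' \<in> Z2 G A" "u \<in> carrier G \<rightarrow> carrier A"
    "\<And>x y. x \<in> carrier G \<Longrightarrow> y \<in> carrier G \<Longrightarrow>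
      f' (x, y) \<otimes>\<^bsub>A\<^esub> u (x \<otimes>\<^bsub>G\<^esub> y) = f (x, y) \<otimes>\<^bsub>A\<^esub> u x \<otimes>\<^bsub>A\<^esub> u y"
proof -
  interpret Z: comm_group "cocycles2 G A" by (rule comm_group_cocycles2)
  obtain u where u: "u \<in> carrier G \<rightarrow> carrier A"
    and f'_eq: "f' = coboundary G A u \<otimes>\<^bsub>cocycles2 G A\<^esub> f"
    using f' by (auto simp: cohomology_class_def r_coset_def B2_def)
  have [simp]: "u v \<in> carrier A" if "v \<in> carrier G" for v using u that by auto
  show thesis
  proof
    show "f' \<in> Z2 G A"
      using Z.m_closed[of "coboundary G A u" f] coboundary_Z2[OF u] f
      unfolding f'_eq by (simp add: cocycles2_def)
    show "f' (x, y) \<otimes>\<^bsub>A\<^esub> u (x \<otimes>\<^bsub>G\<^esub> y) = f (x, y) \<otimes>\<^bsub>A\<^esub> u x \<otimes>\<^bsub>A\<^esub> u y"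
      if xy: "x \<in> carrier G" "y \<in> carrier G" for x y
    proof -
      have "f' (x, y) \<otimes>\<^bsub>A\<^esub> u (x \<otimes>\<^bsub>G\<^esub> y)
          = f (x, y) \<otimes>\<^bsub>A\<^esub> u x \<otimes>\<^bsub>A\<^esub> u y \<otimes>\<^bsub>A\<^esub> (u (x \<otimes>\<^bsub>G\<^esub> y) \<otimes>\<^bsub>A\<^esub> inv\<^bsub>A\<^esub> u (x \<otimes>\<^bsub>G\<^esub> y))"
        using xy Z2_closed[OF f]
        by (simp add: f'_eq cocycles2_def cochains2_def coboundary_def A.m_ac del: A.r_inv A.l_inv)
      then show ?thesis using xy Z2_closed[OF f] by simp
    qed
  qed (rule u)
qed

end

lemma conjugate_cocycle:
  assumes K: "group K" and A: "comm_group A" and f: "f \<in> Z2 K A"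
    and c: "a \<in> carrier K" "b \<in> carrier K" "a' \<in> carrier K" "b' \<in> carrier K"
      "k0 \<in> carrier K" "k1 \<in> carrier K" "k2 \<in> carrier K"
    and e: "a' \<otimes>\<^bsub>K\<^esub> k1 = k0 \<otimes>\<^bsub>K\<^esub> a" "b' \<otimes>\<^bsub>K\<^esub> k2 = k1 \<otimes>\<^bsub>K\<^esub> b"
  shows "f (a', b') \<otimes>\<^bsub>A\<^esub> (f (k0, a) \<otimes>\<^bsub>A\<^esub> f (k1, b) \<otimes>\<^bsub>A\<^esub> f (a' \<otimes>\<^bsub>K\<^esub> b', k2))
    = f (a, b) \<otimes>\<^bsub>A\<^esub> (f (k0, a \<otimes>\<^bsub>K\<^esub> b) \<otimes>\<^bsub>A\<^esub> f (a', k1) \<otimes>\<^bsub>A\<^esub> f (b', k2))"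
proof -
  interpret K: group K by fact
  interpret A: comm_group A by fact
  note cl = Z2_closed[OF f]
  have "f (a', b') \<otimes>\<^bsub>A\<^esub> (f (k0, a) \<otimes>\<^bsub>A\<^esub> f (k1, b) \<otimes>\<^bsub>A\<^esub> f (a' \<otimes>\<^bsub>K\<^esub> b', k2))
      = (f (a' \<otimes>\<^bsub>K\<^esub> b', k2) \<otimes>\<^bsub>A\<^esub> f (a', b')) \<otimes>\<^bsub>A\<^esub> (f (k0, a) \<otimes>\<^bsub>A\<^esub> f (k1, b))"
    using c cl by (simp add: A.m_ac)
  also have "\<dots> = (f (b', k2) \<otimes>\<^bsub>A\<^esub> f (a', k1 \<otimes>\<^bsub>K\<^esub> b)) \<otimes>\<^bsub>A\<^esub> (f (k0, a) \<otimes>\<^bsub>A\<^esub> f (k1, b))"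
    using Z2_cocycle[OF f, of a' b' k2] c e by simp
  also have "\<dots> = (f (k1, b) \<otimes>\<^bsub>A\<^esub> f (a', k1 \<otimes>\<^bsub>K\<^esub> b)) \<otimes>\<^bsub>A\<^esub> (f (k0, a) \<otimes>\<^bsub>A\<^esub> f (b', k2))"
    using c cl by (simp add: A.m_ac)
  also have "\<dots> = (f (k0 \<otimes>\<^bsub>K\<^esub> a, b) \<otimes>\<^bsub>A\<^esub> f (a', k1)) \<otimes>\<^bsub>A\<^esub> (f (k0, a) \<otimes>\<^bsub>A\<^esub> f (b', k2))"
    using Z2_cocycle[OF f, of a' k1 b] c e by simp
  also have "\<dots> = (f (k0 \<otimes>\<^bsub>K\<^esub> a, b) \<otimes>\<^bsub>A\<^esub> f (k0, a)) \<otimes>\<^bsub>A\<^esub> (f (a', k1) \<otimes>\<^bsub>A\<^esub> f (b', k2))"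
    using c cl by (simp add: A.m_ac)
  also have "\<dots> = (f (a, b) \<otimes>\<^bsub>A\<^esub> f (k0, a \<otimes>\<^bsub>K\<^esub> b)) \<otimes>\<^bsub>A\<^esub> (f (a', k1) \<otimes>\<^bsub>A\<^esub> f (b', k2))"
    using Z2_cocycle[OF f, of k0 a b] c by simp
  also have "\<dots> = f (a, b) \<otimes>\<^bsub>A\<^esub> (f (k0, a \<otimes>\<^bsub>K\<^esub> b) \<otimes>\<^bsub>A\<^esub> f (a', k1) \<otimes>\<^bsub>A\<^esub> f (b', k2))"
    using c cl by (simp add: A.m_assoc)
  finally show ?thesis .
qed

context
  fixes G :: "('a, 'm) monoid_scheme" and A :: "('c, 'n) monoid_scheme" and H :: "'a set"
  assumes G: "group G" and A: "comm_group A" and H: "subgroup H G"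
    and fin: "finite (rcosets\<^bsub>G\<^esub> H)"
begin

interpretation G: group G by (rule G)
interpretation A: comm_group A by (rule A)
interpretation H: subgroup H G by (rule H)

private abbreviation (input) "K \<equiv> G\<lparr>carrier := H\<rparr>"

private lemma K: "group K"
  by (rule G.subgroup_imp_group[OF H])

private lemma cancel:
  assumes "a \<in> carrier G" "b \<in> carrier G"
  shows "inv\<^bsub>G\<^esub> a \<otimes>\<^bsub>G\<^esub> (a \<otimes>\<^bsub>G\<^esub> b) = b" "a \<otimes>\<^bsub>G\<^esub> (inv\<^bsub>G\<^esub> a \<otimes>\<^bsub>G\<^esub> b) = b"
  using assms by (simp_all flip: G.m_assoc)

private lemma rcos_mult:
  assumes "C \<in> rcosets\<^bsub>G\<^esub> H" "x \<in> carrier G"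
  shows "C #>\<^bsub>G\<^esub> x \<in> rcosets\<^bsub>G\<^esub> H"
  using assms H.subset by (auto simp: RCOSETS_def G.coset_mult_assoc)

private lemma rcos_mult_assoc:
  assumes "C \<in> rcosets\<^bsub>G\<^esub> H" "x \<in> carrier G" "y \<in> carrier G"
  shows "C #>\<^bsub>G\<^esub> x #>\<^bsub>G\<^esub> y = C #>\<^bsub>G\<^esub> (x \<otimes>\<^bsub>G\<^esub> y)"
  using assms G.rcosets_part_G[OF H] by (intro G.coset_mult_assoc) auto

private lemma rcos_bij:
  assumes x: "x \<in> carrier G"
  shows "bij_betw (\<lambda>C. C #>\<^bsub>G\<^esub> x) (rcosets\<^bsub>G\<^esub> H) (rcosets\<^bsub>G\<^esub> H)"
proof (rule bij_betw_byWitness[where f' = "\<lambda>C. C #>\<^bsub>G\<^esub> inv\<^bsub>G\<^esub> x"])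
  have "C #>\<^bsub>G\<^esub> \<one>\<^bsub>G\<^esub> = C" if "C \<in> rcosets\<^bsub>G\<^esub> H" for C
    using that G.rcosets_part_G[OF H] by (intro G.coset_mult_one) auto
  then show "\<forall>C\<in>rcosets\<^bsub>G\<^esub> H. C #>\<^bsub>G\<^esub> x #>\<^bsub>G\<^esub> inv\<^bsub>G\<^esub> x = C"
    "\<forall>C\<in>rcosets\<^bsub>G\<^esub> H. C #>\<^bsub>G\<^esub> inv\<^bsub>G\<^esub> x #>\<^bsub>G\<^esub> x = C"
    using x by (simp_all add: rcos_mult_assoc)
qed (use x rcos_mult in auto)

private lemma finprod_shift:
  assumes x: "x \<in> carrier G" and w: "w \<in> rcosets\<^bsub>G\<^esub> H \<rightarrow> carrier A"
  shows "(\<Otimes>\<^bsub>A\<^esub>C\<in>rcosets\<^bsub>G\<^esub> H. w (C #>\<^bsub>G\<^esub> x)) = (\<Otimes>\<^bsub>A\<^esub>C\<in>rcosets\<^bsub>G\<^esub> H. w C)"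
  using A.finprod_reindex[of w "\<lambda>C. C #>\<^bsub>G\<^esub> x" "rcosets\<^bsub>G\<^esub> H"] rcos_bij[OF x] w
  by (simp add: bij_betw_def)

private lemma transversal_closed:
  assumes "transversal G H t" "C \<in> rcosets\<^bsub>G\<^esub> H"
  shows "t C \<in> carrier G"
  using assms G.rcosets_part_G[OF H] by (auto simp: transversal_def)

private lemma transversal_mult:
  assumes t: "transversal G H t" and C: "C \<in> rcosets\<^bsub>G\<^esub> H" and y: "y \<in> C"
  shows "y \<otimes>\<^bsub>G\<^esub> inv\<^bsub>G\<^esub> t C \<in> H"
proof -
  obtain z where z: "z \<in> carrier G" "C = H #>\<^bsub>G\<^esub> z" using C by (auto simp: RCOSETS_def)
  then obtain h h' where h: "h \<in> H" "h' \<in> H" "y = h \<otimes>\<^bsub>G\<^esub> z" "t C = h' \<otimes>\<^bsub>G\<^esub> z"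
    using t C y by (auto simp: transversal_def r_coset_def)
  have "y \<otimes>\<^bsub>G\<^esub> inv\<^bsub>G\<^esub> t C = h \<otimes>\<^bsub>G\<^esub> (z \<otimes>\<^bsub>G\<^esub> inv\<^bsub>G\<^esub> z) \<otimes>\<^bsub>G\<^esub> inv\<^bsub>G\<^esub> h'"
    using h z by (simp add: G.inv_mult_group G.m_assoc cancel)
  also have "\<dots> = h \<otimes>\<^bsub>G\<^esub> inv\<^bsub>G\<^esub> h'" using h z by simp
  finally show ?thesis using h by simp
qed

private lemma factor_closed:
  assumes t: "transversal G H t" and C: "C \<in> rcosets\<^bsub>G\<^esub> H" and x: "x \<in> carrier G"
  shows "coset_factor G H t C x \<in> H"
  unfolding coset_factor_def
  using t C by (intro transversal_mult[OF t rcos_mult[OF C x]])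
    (auto simp: transversal_def r_coset_def)

private lemma factor_mult:
  assumes t: "transversal G H t" and C: "C \<in> rcosets\<^bsub>G\<^esub> H"
    and x: "x \<in> carrier G" and y: "y \<in> carrier G"
  shows "coset_factor G H t C x \<otimes>\<^bsub>G\<^esub> coset_factor G H t (C #>\<^bsub>G\<^esub> x) y
    = coset_factor G H t C (x \<otimes>\<^bsub>G\<^esub> y)"
proof -
  note c = transversal_closed[OF t C] transversal_closed[OF t rcos_mult[OF C x]]
    transversal_closed[OF t rcos_mult[OF C G.m_closed[OF x y]]]
  have "coset_factor G H t C x \<otimes>\<^bsub>G\<^esub> coset_factor G H t (C #>\<^bsub>G\<^esub> x) y
    = t C \<otimes>\<^bsub>G\<^esub> x \<otimes>\<^bsub>G\<^esub> (inv\<^bsub>G\<^esub> t (C #>\<^bsub>G\<^esub> x) \<otimes>\<^bsub>G\<^esub> t (C #>\<^bsub>G\<^esub> x)) \<otimes>\<^bsub>G\<^esub> (y \<otimes>\<^bsub>G\<^esub> inv\<^bsub>G\<^esub> t (C #>\<^bsub>G\<^esub> (x \<otimes>\<^bsub>G\<^esub> y)))"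
    using c x y by (simp add: coset_factor_def rcos_mult_assoc[OF C x y] G.m_assoc cancel)
  then show ?thesis using c x y by (simp add: coset_factor_def G.m_assoc)
qed

lemma corestriction_cochain_Z2:
  assumes t: "transversal G H t" and f: "f \<in> Z2 (G\<lparr>carrier := H\<rparr>) A"
  shows "corestriction_cochain G A H t f \<in> Z2 G A"
  unfolding corestriction_cochain_def
proof (rule Z2_I[OF _ _ G])
  note cl = Z2_closed[OF f, simplified]
  let ?c = "coset_factor G H t"
  note fc = factor_closed[OF t]
  show "(\<Otimes>\<^bsub>A\<^esub>C\<in>rcosets\<^bsub>G\<^esub> H. f (?c C x, ?c (C #>\<^bsub>G\<^esub> x) y)) \<in> carrier A"
    if "x \<in> carrier G" "y \<in> carrier G" for x y
    using that by (intro A.finprod_closed) (auto intro!: cl fc rcos_mult)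
  fix x y z assume xyz: "x \<in> carrier G" "y \<in> carrier G" "z \<in> carrier G"
  have "(\<Otimes>\<^bsub>A\<^esub>C\<in>rcosets\<^bsub>G\<^esub> H. f (?c C y, ?c (C #>\<^bsub>G\<^esub> y) z)) \<otimes>\<^bsub>A\<^esub>
      (\<Otimes>\<^bsub>A\<^esub>C\<in>rcosets\<^bsub>G\<^esub> H. f (?c C x, ?c (C #>\<^bsub>G\<^esub> x) (y \<otimes>\<^bsub>G\<^esub> z)))
    = (\<Otimes>\<^bsub>A\<^esub>C\<in>rcosets\<^bsub>G\<^esub> H. f (?c (C #>\<^bsub>G\<^esub> x) y, ?c (C #>\<^bsub>G\<^esub> x #>\<^bsub>G\<^esub> y) z)) \<otimes>\<^bsub>A\<^esub>
      (\<Otimes>\<^bsub>A\<^esub>C\<in>rcosets\<^bsub>G\<^esub> H. f (?c C x, ?c (C #>\<^bsub>G\<^esub> x) (y \<otimes>\<^bsub>G\<^esub> z)))"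
    using xyz by (subst finprod_shift[of x "\<lambda>C. f (?c C y, ?c (C #>\<^bsub>G\<^esub> y) z)"])
      (auto intro!: cl fc rcos_mult)
  also have "\<dots> = (\<Otimes>\<^bsub>A\<^esub>C\<in>rcosets\<^bsub>G\<^esub> H. f (?c (C #>\<^bsub>G\<^esub> x) y, ?c (C #>\<^bsub>G\<^esub> x #>\<^bsub>G\<^esub> y) z) \<otimes>\<^bsub>A\<^esub>
      f (?c C x, ?c (C #>\<^bsub>G\<^esub> x) (y \<otimes>\<^bsub>G\<^esub> z)))"
    using xyz by (intro A.finprod_multf[symmetric]) (auto intro!: cl fc rcos_mult)
  also have "\<dots> = (\<Otimes>\<^bsub>A\<^esub>C\<in>rcosets\<^bsub>G\<^esub> H. f (?c C (x \<otimes>\<^bsub>G\<^esub> y), ?c (C #>\<^bsub>G\<^esub> (x \<otimes>\<^bsub>G\<^esub> y)) z) \<otimes>\<^bsub>A\<^esub>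
      f (?c C x, ?c (C #>\<^bsub>G\<^esub> x) y))"
  proof (rule A.finprod_cong')
    fix C assume C: "C \<in> rcosets\<^bsub>G\<^esub> H"
    show "f (?c (C #>\<^bsub>G\<^esub> x) y, ?c (C #>\<^bsub>G\<^esub> x #>\<^bsub>G\<^esub> y) z) \<otimes>\<^bsub>A\<^esub> f (?c C x, ?c (C #>\<^bsub>G\<^esub> x) (y \<otimes>\<^bsub>G\<^esub> z))
      = f (?c C (x \<otimes>\<^bsub>G\<^esub> y), ?c (C #>\<^bsub>G\<^esub> (x \<otimes>\<^bsub>G\<^esub> y)) z) \<otimes>\<^bsub>A\<^esub> f (?c C x, ?c (C #>\<^bsub>G\<^esub> x) y)"
      using Z2_cocycle[OF f, of "?c C x" "?c (C #>\<^bsub>G\<^esub> x) y" "?c (C #>\<^bsub>G\<^esub> x #>\<^bsub>G\<^esub> y) z"] C xyz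
      by (simp add: fc rcos_mult rcos_mult_assoc
          factor_mult[OF t C xyz(1,2)] factor_mult[OF t rcos_mult[OF C xyz(1)] xyz(2,3), unfolded rcos_mult_assoc[OF C xyz(1,2)]])
  qed (use xyz in \<open>auto intro!: cl fc rcos_mult\<close>)
  also have "\<dots> = (\<Otimes>\<^bsub>A\<^esub>C\<in>rcosets\<^bsub>G\<^esub> H. f (?c C (x \<otimes>\<^bsub>G\<^esub> y), ?c (C #>\<^bsub>G\<^esub> (x \<otimes>\<^bsub>G\<^esub> y)) z)) \<otimes>\<^bsub>A\<^esub>
      (\<Otimes>\<^bsub>A\<^esub>C\<in>rcosets\<^bsub>G\<^esub> H. f (?c C x, ?c (C #>\<^bsub>G\<^esub> x) y))"
    using xyz by (intro A.finprod_multf) (auto intro!: cl fc rcos_mult)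
  finally show "(\<Otimes>\<^bsub>A\<^esub>C\<in>rcosets\<^bsub>G\<^esub> H. f (?c C y, ?c (C #>\<^bsub>G\<^esub> y) z)) \<otimes>\<^bsub>A\<^esub>
      (\<Otimes>\<^bsub>A\<^esub>C\<in>rcosets\<^bsub>G\<^esub> H. f (?c C x, ?c (C #>\<^bsub>G\<^esub> x) (y \<otimes>\<^bsub>G\<^esub> z))) = \<dots>" .
qed

lemma corestriction_cochain_cohomologous:
  assumes t: "transversal G H t" and t': "transversal G H t'"
    and f: "f \<in> Z2 (G\<lparr>carrier := H\<rparr>) A"
    and f': "f' \<in> cohomology_class (G\<lparr>carrier := H\<rparr>) A f"
  shows "cohomology_class G A (corestriction_cochain G A H t' f')
    = cohomology_class G A (corestriction_cochain G A H t f)"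
proof -
  obtain u where f'Z: "f' \<in> Z2 K A" and u: "u \<in> H \<rightarrow> carrier A"
    and fu: "\<And>a b. a \<in> H \<Longrightarrow> b \<in> H \<Longrightarrow>
      f' (a, b) \<otimes>\<^bsub>A\<^esub> u (a \<otimes>\<^bsub>G\<^esub> b) = f (a, b) \<otimes>\<^bsub>A\<^esub> u a \<otimes>\<^bsub>A\<^esub> u b"
    using cohomology_class_memD[OF K A f f'] by auto
  note cl = Z2_closed[OF f, simplified] and cl' = Z2_closed[OF f'Z, simplified]
  have ucl: "u a \<in> carrier A" if "a \<in> H" for a using u that by auto
  let ?c = "coset_factor G H t" and ?d = "coset_factor G H t'"
  define k where "k C = t' C \<otimes>\<^bsub>G\<^esub> inv\<^bsub>G\<^esub> t C" for C
  have k: "k C \<in> H" if "C \<in> rcosets\<^bsub>G\<^esub> H" for C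
    unfolding k_def using t' that by (intro transversal_mult[OF t that]) (auto simp: transversal_def)
  note fc = factor_closed[OF t] factor_closed[OF t'] k
  have dk: "?d C x \<otimes>\<^bsub>G\<^esub> k (C #>\<^bsub>G\<^esub> x) = k C \<otimes>\<^bsub>G\<^esub> ?c C x"
    if C: "C \<in> rcosets\<^bsub>G\<^esub> H" and x: "x \<in> carrier G" for C x
  proof -
    note c = transversal_closed[OF t C] transversal_closed[OF t rcos_mult[OF C x]]
      transversal_closed[OF t' C] transversal_closed[OF t' rcos_mult[OF C x]]
    have "?d C x \<otimes>\<^bsub>G\<^esub> k (C #>\<^bsub>G\<^esub> x) = t' C \<otimes>\<^bsub>G\<^esub> x \<otimes>\<^bsub>G\<^esub>
        (inv\<^bsub>G\<^esub> t' (C #>\<^bsub>G\<^esub> x) \<otimes>\<^bsub>G\<^esub> t' (C #>\<^bsub>G\<^esub> x)) \<otimes>\<^bsub>G\<^esub> inv\<^bsub>G\<^esub> t (C #>\<^bsub>G\<^esub> x)"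
      using c x by (simp add: coset_factor_def k_def G.m_assoc cancel)
    moreover have "k C \<otimes>\<^bsub>G\<^esub> ?c C x = t' C \<otimes>\<^bsub>G\<^esub> (inv\<^bsub>G\<^esub> t C \<otimes>\<^bsub>G\<^esub> t C) \<otimes>\<^bsub>G\<^esub> x \<otimes>\<^bsub>G\<^esub> inv\<^bsub>G\<^esub> t (C #>\<^bsub>G\<^esub> x)"
      using c x by (simp add: coset_factor_def k_def G.m_assoc cancel)
    ultimately show ?thesis using c x by simp
  qed
  define w where "w C x = u (?d C x) \<otimes>\<^bsub>A\<^esub> (f (?d C x, k (C #>\<^bsub>G\<^esub> x)) \<otimes>\<^bsub>A\<^esub> inv\<^bsub>A\<^esub> f (k C, ?c C x))" for C x
  have w: "w C x \<in> carrier A" if "C \<in> rcosets\<^bsub>G\<^esub> H" "x \<in> carrier G" for C x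
    unfolding w_def using that by (auto intro!: cl ucl fc rcos_mult)
  have pointwise: "f' (?d C x, ?d (C #>\<^bsub>G\<^esub> x) y) \<otimes>\<^bsub>A\<^esub> w C (x \<otimes>\<^bsub>G\<^esub> y)
      = f (?c C x, ?c (C #>\<^bsub>G\<^esub> x) y) \<otimes>\<^bsub>A\<^esub> w C x \<otimes>\<^bsub>A\<^esub> w (C #>\<^bsub>G\<^esub> x) y"
    if C: "C \<in> rcosets\<^bsub>G\<^esub> H" and x: "x \<in> carrier G" and y: "y \<in> carrier G" for C x y
  proof -
    let ?a = "?c C x" and ?b = "?c (C #>\<^bsub>G\<^esub> x) y" and ?a' = "?d C x" and ?b' = "?d (C #>\<^bsub>G\<^esub> x) y"
    let ?k0 = "k C" and ?k1 = "k (C #>\<^bsub>G\<^esub> x)" and ?k2 = "k (C #>\<^bsub>G\<^esub> (x \<otimes>\<^bsub>G\<^esub> y))"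
    have ab: "?a \<in> H" "?b \<in> H" "?a' \<in> H" "?b' \<in> H" "?k0 \<in> H" "?k1 \<in> H" "?k2 \<in> H"
      using C x y by (auto intro!: fc rcos_mult)
    have e: "?a' \<otimes>\<^bsub>G\<^esub> ?k1 = ?k0 \<otimes>\<^bsub>G\<^esub> ?a" "?b' \<otimes>\<^bsub>G\<^esub> ?k2 = ?k1 \<otimes>\<^bsub>G\<^esub> ?b"
      using dk[OF C x] dk[OF rcos_mult[OF C x] y] by (simp_all add: rcos_mult_assoc[OF C x y])
    have m: "?c C (x \<otimes>\<^bsub>G\<^esub> y) = ?a \<otimes>\<^bsub>G\<^esub> ?b" "?d C (x \<otimes>\<^bsub>G\<^esub> y) = ?a' \<otimes>\<^bsub>G\<^esub> ?b'"
      using factor_mult[OF t C x y] factor_mult[OF t' C x y] by simp_all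
    have main: "f (?a', ?b') \<otimes>\<^bsub>A\<^esub> (f (?k0, ?a) \<otimes>\<^bsub>A\<^esub> f (?k1, ?b) \<otimes>\<^bsub>A\<^esub> f (?a' \<otimes>\<^bsub>G\<^esub> ?b', ?k2))
      = f (?a, ?b) \<otimes>\<^bsub>A\<^esub> (f (?k0, ?a \<otimes>\<^bsub>G\<^esub> ?b) \<otimes>\<^bsub>A\<^esub> f (?a', ?k1) \<otimes>\<^bsub>A\<^esub> f (?b', ?k2))"
      using conjugate_cocycle[OF K A f, of ?a ?b ?a' ?b' ?k0 ?k1 ?k2] ab e by simp
    define p q r P Q R F F' F0 U where
      "p = f (?k0, ?a)" and "q = f (?k1, ?b)" and "r = f (?k0, ?a \<otimes>\<^bsub>G\<^esub> ?b)" and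
      "P = f (?a', ?k1)" and "Q = f (?b', ?k2)" and "R = f (?a' \<otimes>\<^bsub>G\<^esub> ?b', ?k2)" and
      "F = f (?a, ?b)" and "F' = f' (?a', ?b')" and "F0 = f (?a', ?b')" and "U = u (?a' \<otimes>\<^bsub>G\<^esub> ?b')"
    note defs = this
    have A': "p \<in> carrier A" "q \<in> carrier A" "r \<in> carrier A" "P \<in> carrier A" "Q \<in> carrier A"
      "R \<in> carrier A" "F \<in> carrier A" "F' \<in> carrier A" "F0 \<in> carrier A" "U \<in> carrier A"
      "u ?a' \<in> carrier A" "u ?b' \<in> carrier A"
      unfolding defs using ab by (auto intro!: cl cl' ucl)
    have ac: "a \<otimes>\<^bsub>A\<^esub> (inv\<^bsub>A\<^esub> a \<otimes>\<^bsub>A\<^esub> b) = b" "inv\<^bsub>A\<^esub> a \<otimes>\<^bsub>A\<^esub> (a \<otimes>\<^bsub>A\<^esub> b) = b"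
      if "a \<in> carrier A" "b \<in> carrier A" for a b
      using that by (simp_all flip: A.m_assoc)
    have m1: "F0 \<otimes>\<^bsub>A\<^esub> (p \<otimes>\<^bsub>A\<^esub> q \<otimes>\<^bsub>A\<^esub> R) = F \<otimes>\<^bsub>A\<^esub> (r \<otimes>\<^bsub>A\<^esub> P \<otimes>\<^bsub>A\<^esub> Q)"
      using main by (simp add: defs)
    have m2: "F' \<otimes>\<^bsub>A\<^esub> U = F0 \<otimes>\<^bsub>A\<^esub> u ?a' \<otimes>\<^bsub>A\<^esub> u ?b'"
      using fu[of ?a' ?b'] ab by (simp add: defs)
    have "F' \<otimes>\<^bsub>A\<^esub> (U \<otimes>\<^bsub>A\<^esub> (R \<otimes>\<^bsub>A\<^esub> inv\<^bsub>A\<^esub> r)) \<otimes>\<^bsub>A\<^esub> (p \<otimes>\<^bsub>A\<^esub> q)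
        = (F' \<otimes>\<^bsub>A\<^esub> U) \<otimes>\<^bsub>A\<^esub> (R \<otimes>\<^bsub>A\<^esub> inv\<^bsub>A\<^esub> r) \<otimes>\<^bsub>A\<^esub> (p \<otimes>\<^bsub>A\<^esub> q)"
      using A' by (simp add: A.m_ac)
    also have "\<dots> = (F0 \<otimes>\<^bsub>A\<^esub> (p \<otimes>\<^bsub>A\<^esub> q \<otimes>\<^bsub>A\<^esub> R)) \<otimes>\<^bsub>A\<^esub> (inv\<^bsub>A\<^esub> r \<otimes>\<^bsub>A\<^esub> u ?a' \<otimes>\<^bsub>A\<^esub> u ?b')"
      unfolding m2 using A' by (simp add: A.m_ac)
    also have "\<dots> = F \<otimes>\<^bsub>A\<^esub> (P \<otimes>\<^bsub>A\<^esub> Q \<otimes>\<^bsub>A\<^esub> u ?a' \<otimes>\<^bsub>A\<^esub> u ?b') \<otimes>\<^bsub>A\<^esub> (r \<otimes>\<^bsub>A\<^esub> inv\<^bsub>A\<^esub> r)"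
      unfolding m1 using A' by (simp add: A.m_ac ac)
    also have "\<dots> = F \<otimes>\<^bsub>A\<^esub> (P \<otimes>\<^bsub>A\<^esub> Q \<otimes>\<^bsub>A\<^esub> u ?a' \<otimes>\<^bsub>A\<^esub> u ?b') \<otimes>\<^bsub>A\<^esub> ((p \<otimes>\<^bsub>A\<^esub> inv\<^bsub>A\<^esub> p) \<otimes>\<^bsub>A\<^esub> (q \<otimes>\<^bsub>A\<^esub> inv\<^bsub>A\<^esub> q))"
      using A' by simp
    also have "\<dots> = F \<otimes>\<^bsub>A\<^esub> (u ?a' \<otimes>\<^bsub>A\<^esub> (P \<otimes>\<^bsub>A\<^esub> inv\<^bsub>A\<^esub> p)) \<otimes>\<^bsub>A\<^esub> (u ?b' \<otimes>\<^bsub>A\<^esub> (Q \<otimes>\<^bsub>A\<^esub> inv\<^bsub>A\<^esub> q)) \<otimes>\<^bsub>A\<^esub> (p \<otimes>\<^bsub>A\<^esub> q)"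
      using A' by (simp add: A.m_ac ac)
    finally have "F' \<otimes>\<^bsub>A\<^esub> (U \<otimes>\<^bsub>A\<^esub> (R \<otimes>\<^bsub>A\<^esub> inv\<^bsub>A\<^esub> r))
        = F \<otimes>\<^bsub>A\<^esub> (u ?a' \<otimes>\<^bsub>A\<^esub> (P \<otimes>\<^bsub>A\<^esub> inv\<^bsub>A\<^esub> p)) \<otimes>\<^bsub>A\<^esub> (u ?b' \<otimes>\<^bsub>A\<^esub> (Q \<otimes>\<^bsub>A\<^esub> inv\<^bsub>A\<^esub> q))"
      using A' by (subst (asm) A.right_cancel) auto
    then show ?thesis
      by (simp add: w_def m defs rcos_mult_assoc[OF C x y])
  qed
  define W where "W x = (\<Otimes>\<^bsub>A\<^esub>C\<in>rcosets\<^bsub>G\<^esub> H. w C x)" for x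
  show ?thesis
  proof (rule cohomology_class_eqI[OF G A corestriction_cochain_Z2[OF t f]
        corestriction_cochain_Z2[OF t' f'Z], where u = W])
    show "W \<in> carrier G \<rightarrow> carrier A" unfolding W_def using w by (auto intro!: A.finprod_closed)
    fix x y assume xy: "x \<in> carrier G" "y \<in> carrier G"
    have "(\<Otimes>\<^bsub>A\<^esub>C\<in>rcosets\<^bsub>G\<^esub> H. f' (?d C x, ?d (C #>\<^bsub>G\<^esub> x) y)) \<otimes>\<^bsub>A\<^esub> W (x \<otimes>\<^bsub>G\<^esub> y)
      = (\<Otimes>\<^bsub>A\<^esub>C\<in>rcosets\<^bsub>G\<^esub> H. f' (?d C x, ?d (C #>\<^bsub>G\<^esub> x) y) \<otimes>\<^bsub>A\<^esub> w C (x \<otimes>\<^bsub>G\<^esub> y))"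
      unfolding W_def using xy by (intro A.finprod_multf[symmetric]) (auto intro!: cl' fc rcos_mult w)
    also have "\<dots> = (\<Otimes>\<^bsub>A\<^esub>C\<in>rcosets\<^bsub>G\<^esub> H. f (?c C x, ?c (C #>\<^bsub>G\<^esub> x) y) \<otimes>\<^bsub>A\<^esub> w C x \<otimes>\<^bsub>A\<^esub> w (C #>\<^bsub>G\<^esub> x) y)"
      using xy pointwise by (intro A.finprod_cong') (auto intro!: cl fc rcos_mult w)
    also have "\<dots> = (\<Otimes>\<^bsub>A\<^esub>C\<in>rcosets\<^bsub>G\<^esub> H. f (?c C x, ?c (C #>\<^bsub>G\<^esub> x) y) \<otimes>\<^bsub>A\<^esub> w C x) \<otimes>\<^bsub>A\<^esub>
        (\<Otimes>\<^bsub>A\<^esub>C\<in>rcosets\<^bsub>G\<^esub> H. w (C #>\<^bsub>G\<^esub> x) y)"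
      using xy by (intro A.finprod_multf) (auto intro!: cl fc rcos_mult w)
    also have "\<dots> = (\<Otimes>\<^bsub>A\<^esub>C\<in>rcosets\<^bsub>G\<^esub> H. f (?c C x, ?c (C #>\<^bsub>G\<^esub> x) y)) \<otimes>\<^bsub>A\<^esub> W x \<otimes>\<^bsub>A\<^esub>
        (\<Otimes>\<^bsub>A\<^esub>C\<in>rcosets\<^bsub>G\<^esub> H. w (C #>\<^bsub>G\<^esub> x) y)"
      unfolding W_def using xy by (subst A.finprod_multf) (auto intro!: cl fc rcos_mult w)
    also have "(\<Otimes>\<^bsub>A\<^esub>C\<in>rcosets\<^bsub>G\<^esub> H. w (C #>\<^bsub>G\<^esub> x) y) = W y"
      unfolding W_def using xy by (intro finprod_shift[of x "\<lambda>C. w C y"]) (auto intro!: w)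
    finally show "corestriction_cochain G A H t' f' (x, y) \<otimes>\<^bsub>A\<^esub> W (x \<otimes>\<^bsub>G\<^esub> y)
      = corestriction_cochain G A H t f (x, y) \<otimes>\<^bsub>A\<^esub> W x \<otimes>\<^bsub>A\<^esub> W y"
      using xy by (simp add: corestriction_cochain_def)
  qed
qed

lemma corestriction_class:
  assumes t: "transversal G H t" and f: "f \<in> Z2 (G\<lparr>carrier := H\<rparr>) A"
  shows "corestriction G A H (cohomology_class (G\<lparr>carrier := H\<rparr>) A f)
    = cohomology_class G A (corestriction_cochain G A H t f)"
proof -
  have "C \<noteq> {}" if "C \<in> rcosets\<^bsub>G\<^esub> H" for C
    using that G.rcos_self[OF _ H] by (auto simp: RCOSETS_def)
  then have t0: "transversal G H (\<lambda>C. SOME x. x \<in> C)"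
    by (auto simp: transversal_def some_in_eq)
  have "(\<lambda>f'. cohomology_class G A (corestriction_cochain G A H (\<lambda>C. SOME x. x \<in> C) f')) `
      cohomology_class K A f = {cohomology_class G A (corestriction_cochain G A H t f)}"
    using corestriction_cochain_cohomologous[OF t t0 f] cohomology_class_self[OF K A f] by auto
  then show ?thesis by (simp add: corestriction_def)
qed

end

context
  fixes A :: "('c, 'n) monoid_scheme" and \<iota> :: "'c \<Rightarrow> 'e" and E :: "('e, 'k) monoid_scheme"
    and \<pi> :: "'e \<Rightarrow> 'a" and G :: "('a, 'm) monoid_scheme"
  assumes G: "group G" and A: "comm_group A" and ext: "central_extension A \<iota> E \<pi> G"
begin

interpretation G: group G by (rule G)
interpretation A: comm_group A by (rule A)
interpretation E: group E using ext by (simp add: central_extension_def)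

private lemma io: "\<iota> \<in> hom A E" "inj_on \<iota> (carrier A)" "\<iota> ` carrier A = kernel E G \<pi>"
  using ext by (auto simp: central_extension_def mon_def)

private lemma io_closed: "a \<in> carrier A \<Longrightarrow> \<iota> a \<in> carrier E"
  using io(1) by (auto simp: hom_def)

private lemma io_mult: "a \<in> carrier A \<Longrightarrow> b \<in> carrier A \<Longrightarrow> \<iota> (a \<otimes>\<^bsub>A\<^esub> b) = \<iota> a \<otimes>\<^bsub>E\<^esub> \<iota> b"
  using io(1) by (auto simp: hom_def)

private lemma io_central: "a \<in> carrier A \<Longrightarrow> e \<in> carrier E \<Longrightarrow> \<iota> a \<otimes>\<^bsub>E\<^esub> e = e \<otimes>\<^bsub>E\<^esub> \<iota> a"
  using ext by (auto simp: central_extension_def)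

private lemma hom_pi: "group_hom E G \<pi>"
  using ext G E.group_axioms
  by (auto simp: central_extension_def epi_def group_hom_def group_hom_axioms_def)

interpretation \<pi>: group_hom E G \<pi> by (rule hom_pi)

private lemma quotient_in_A:
  assumes "p \<in> carrier E" "q \<in> carrier E" "\<pi> p = \<pi> q"
  shows "inv_into (carrier A) \<iota> (p \<otimes>\<^bsub>E\<^esub> inv\<^bsub>E\<^esub> q) \<in> carrier A"
    "\<iota> (inv_into (carrier A) \<iota> (p \<otimes>\<^bsub>E\<^esub> inv\<^bsub>E\<^esub> q)) \<otimes>\<^bsub>E\<^esub> q = p"
proof -
  have im: "p \<otimes>\<^bsub>E\<^esub> inv\<^bsub>E\<^esub> q \<in> \<iota> ` carrier A"
    using assms by (simp add: io(3) kernel_def)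
  show "inv_into (carrier A) \<iota> (p \<otimes>\<^bsub>E\<^esub> inv\<^bsub>E\<^esub> q) \<in> carrier A"
    by (rule inv_into_into[OF im])
  show "\<iota> (inv_into (carrier A) \<iota> (p \<otimes>\<^bsub>E\<^esub> inv\<^bsub>E\<^esub> q)) \<otimes>\<^bsub>E\<^esub> q = p"
    using assms by (simp add: f_inv_into_f[OF im] E.m_assoc)
qed

lemma section_cocycle:
  assumes s: "\<And>x. x \<in> carrier G \<Longrightarrow> s x \<in> carrier E \<and> \<pi> (s x) = x"
    and xy: "x \<in> carrier G" "y \<in> carrier G"
  shows "section_cocycle A \<iota> E G s (x, y) \<in> carrier A"
    and "s x \<otimes>\<^bsub>E\<^esub> s y = \<iota> (section_cocycle A \<iota> E G s (x, y)) \<otimes>\<^bsub>E\<^esub> s (x \<otimes>\<^bsub>G\<^esub> y)"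
  using quotient_in_A[of "s x \<otimes>\<^bsub>E\<^esub> s y" "s (x \<otimes>\<^bsub>G\<^esub> y)"] s xy
  by (simp_all add: section_cocycle_def)

private lemma io_cancel:
  assumes "a \<in> carrier A" "b \<in> carrier A" "e \<in> carrier E" "\<iota> a \<otimes>\<^bsub>E\<^esub> e = \<iota> b \<otimes>\<^bsub>E\<^esub> e"
  shows "a = b"
  using assms io(2) io_closed by (auto dest: inj_onD)

lemma section_cocycle_Z2:
  assumes s: "\<And>x. x \<in> carrier G \<Longrightarrow> s x \<in> carrier E \<and> \<pi> (s x) = x"
  shows "section_cocycle A \<iota> E G s \<in> Z2 G A"
proof -
  let ?f = "section_cocycle A \<iota> E G s"
  note f = section_cocycle[of s, OF s]
  have "(\<lambda>(x, y)\<in>carrier G \<times> carrier G. ?f (x, y)) \<in> Z2 G A"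
  proof (rule Z2_I[OF _ _ G])
    show "?f (x, y) \<in> carrier A" if "x \<in> carrier G" "y \<in> carrier G" for x y
      using f(1) that by simp
    fix x y z assume xyz: "x \<in> carrier G" "y \<in> carrier G" "z \<in> carrier G"
    have c: "s x \<in> carrier E" "s y \<in> carrier E" "s z \<in> carrier E" "s (x \<otimes>\<^bsub>G\<^esub> y \<otimes>\<^bsub>G\<^esub> z) \<in> carrier E"
      "s (y \<otimes>\<^bsub>G\<^esub> z) \<in> carrier E" "s (x \<otimes>\<^bsub>G\<^esub> y) \<in> carrier E"
      using s xyz by auto
    have d: "?f (y, z) \<in> carrier A" "?f (x, y \<otimes>\<^bsub>G\<^esub> z) \<in> carrier A"
      "?f (x \<otimes>\<^bsub>G\<^esub> y, z) \<in> carrier A" "?f (x, y) \<in> carrier A"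
      using f(1) xyz by auto
    have "\<iota> (?f (y, z) \<otimes>\<^bsub>A\<^esub> ?f (x, y \<otimes>\<^bsub>G\<^esub> z)) \<otimes>\<^bsub>E\<^esub> s (x \<otimes>\<^bsub>G\<^esub> y \<otimes>\<^bsub>G\<^esub> z)
        = \<iota> (?f (y, z)) \<otimes>\<^bsub>E\<^esub> (s x \<otimes>\<^bsub>E\<^esub> s (y \<otimes>\<^bsub>G\<^esub> z))"
      using f(2)[of x "y \<otimes>\<^bsub>G\<^esub> z"] xyz c d by (simp add: io_mult io_closed E.m_assoc G.m_assoc)
    also have "\<dots> = s x \<otimes>\<^bsub>E\<^esub> (\<iota> (?f (y, z)) \<otimes>\<^bsub>E\<^esub> s (y \<otimes>\<^bsub>G\<^esub> z))"
      using c d io_central[of "?f (y, z)" "s x"] by (simp add: io_closed flip: E.m_assoc)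
    also have "\<dots> = (s x \<otimes>\<^bsub>E\<^esub> s y) \<otimes>\<^bsub>E\<^esub> s z"
      using f(2)[of y z] xyz c by (simp add: E.m_assoc)
    also have "\<dots> = \<iota> (?f (x, y)) \<otimes>\<^bsub>E\<^esub> (s (x \<otimes>\<^bsub>G\<^esub> y) \<otimes>\<^bsub>E\<^esub> s z)"
      using f(2)[of x y] xyz c d by (simp add: io_closed E.m_assoc)
    also have "\<dots> = \<iota> (?f (x, y) \<otimes>\<^bsub>A\<^esub> ?f (x \<otimes>\<^bsub>G\<^esub> y, z)) \<otimes>\<^bsub>E\<^esub> s (x \<otimes>\<^bsub>G\<^esub> y \<otimes>\<^bsub>G\<^esub> z)"
      using f(2)[of "x \<otimes>\<^bsub>G\<^esub> y" z] xyz c d by (simp add: io_mult io_closed E.m_assoc)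
    finally have "?f (y, z) \<otimes>\<^bsub>A\<^esub> ?f (x, y \<otimes>\<^bsub>G\<^esub> z) = ?f (x, y) \<otimes>\<^bsub>A\<^esub> ?f (x \<otimes>\<^bsub>G\<^esub> y, z)"
      using c d by (intro io_cancel[where e = "s (x \<otimes>\<^bsub>G\<^esub> y \<otimes>\<^bsub>G\<^esub> z)"]) auto
    then show "?f (y, z) \<otimes>\<^bsub>A\<^esub> ?f (x, y \<otimes>\<^bsub>G\<^esub> z) = ?f (x \<otimes>\<^bsub>G\<^esub> y, z) \<otimes>\<^bsub>A\<^esub> ?f (x, y)"
      using d by (simp add: A.m_comm)
  qed
  moreover have "(\<lambda>(x, y)\<in>carrier G \<times> carrier G. ?f (x, y)) = ?f"
    by (auto simp: section_cocycle_def)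
  ultimately show ?thesis by simp
qed

lemma extension_class_eq:
  assumes s: "\<And>x. x \<in> carrier G \<Longrightarrow> s x \<in> carrier E \<and> \<pi> (s x) = x"
  shows "extension_class A \<iota> E \<pi> G = cohomology_class G A (section_cocycle A \<iota> E G s)"
proof -
  define r where "r = inv_into (carrier E) \<pi>"
  have "\<pi> ` carrier E = carrier G" using ext by (simp add: central_extension_def epi_def)
  then have r: "r x \<in> carrier E \<and> \<pi> (r x) = x" if "x \<in> carrier G" for x
    using that unfolding r_def by (metis f_inv_into_f inv_into_into)
  define v where "v x = inv_into (carrier A) \<iota> (r x \<otimes>\<^bsub>E\<^esub> inv\<^bsub>E\<^esub> s x)" for x
  have v: "v x \<in> carrier A" "\<iota> (v x) \<otimes>\<^bsub>E\<^esub> s x = r x" if "x \<in> carrier G" for x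
    unfolding v_def using quotient_in_A[of "r x" "s x"] r s that by auto
  let ?f = "section_cocycle A \<iota> E G s" and ?f' = "section_cocycle A \<iota> E G r"
  note f = section_cocycle[of s, OF s] and f' = section_cocycle[of r, OF r]
  have "cohomology_class G A ?f' = cohomology_class G A ?f"
  proof (rule cohomology_class_eqI[OF G A, where u = v])
    fix x y assume xy: "x \<in> carrier G" "y \<in> carrier G"
    note c = s[OF xy(1)] s[OF xy(2)] s[OF G.m_closed[OF xy]]
    note d = f(1)[OF _ xy] f'(1)[OF _ xy] v(1)[OF xy(1)] v(1)[OF xy(2)] v(1)[OF G.m_closed[OF xy]]
    have "\<iota> (?f' (x, y) \<otimes>\<^bsub>A\<^esub> v (x \<otimes>\<^bsub>G\<^esub> y)) \<otimes>\<^bsub>E\<^esub> s (x \<otimes>\<^bsub>G\<^esub> y) = r x \<otimes>\<^bsub>E\<^esub> r y"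
      using f'(2)[OF _ xy] c d v(2)[OF G.m_closed[OF xy]] by (simp add: io_mult io_closed E.m_assoc)
    also have "\<dots> = \<iota> (v x) \<otimes>\<^bsub>E\<^esub> (s x \<otimes>\<^bsub>E\<^esub> \<iota> (v y)) \<otimes>\<^bsub>E\<^esub> s y"
      using c d v(2)[OF xy(1), symmetric] v(2)[OF xy(2), symmetric] by (simp add: io_closed E.m_assoc)
    also have "\<dots> = \<iota> (v x) \<otimes>\<^bsub>E\<^esub> \<iota> (v y) \<otimes>\<^bsub>E\<^esub> (s x \<otimes>\<^bsub>E\<^esub> s y)"
      using c d by (simp add: io_central[symmetric]) (simp add: io_closed E.m_assoc)
    also have "\<dots> = \<iota> (v x \<otimes>\<^bsub>A\<^esub> v y \<otimes>\<^bsub>A\<^esub> ?f (x, y)) \<otimes>\<^bsub>E\<^esub> s (x \<otimes>\<^bsub>G\<^esub> y)"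
      using c d f(2)[OF _ xy] by (simp add: io_mult io_closed E.m_assoc)
    finally have "?f' (x, y) \<otimes>\<^bsub>A\<^esub> v (x \<otimes>\<^bsub>G\<^esub> y) = v x \<otimes>\<^bsub>A\<^esub> v y \<otimes>\<^bsub>A\<^esub> ?f (x, y)"
      using c d by (intro io_cancel[where e = "s (x \<otimes>\<^bsub>G\<^esub> y)"]) auto
    then show "?f' (x, y) \<otimes>\<^bsub>A\<^esub> v (x \<otimes>\<^bsub>G\<^esub> y) = ?f (x, y) \<otimes>\<^bsub>A\<^esub> v x \<otimes>\<^bsub>A\<^esub> v y"
      using d by (simp add: A.m_ac)
  qed (use v section_cocycle_Z2[of s, OF s] section_cocycle_Z2[of r, OF r] in auto)
  then show ?thesis by (simp add: extension_class_def r_def)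
qed

end

end

theory Submission
  imports Defs
begin

text \<open>If \<open>x\<^sup>n = \<one>\<close> and \<open>n\<close> annihilates \<open>A\<close>, then every lift of \<open>x\<close> to the extension with cocycle
  \<open>f\<close> has the same \<open>n\<close>-th power, the image of \<open>\<Prod>i<n. f (x\<^sup>i, x)\<close>. For a subgroup \<open>H\<close> of index 2,
  the restriction to \<open>H\<close> of the corestriction of \<open>f\<close> is the product of \<open>f\<close> and its conjugate by
  \<open>g\<close>. Hence the \<open>n\<close>-th power of a lift of \<open>h \<in> H\<close> to \<open>H\<^sub>1\<close> is \<open>a b\<close>, where \<open>a\<close> and \<open>b\<close> are the
  \<open>n\<close>-th powers of lifts of \<open>h\<close> and \<open>g h g\<inverse>\<close> to \<open>H\<^sub>2\<close>. With \<open>n = exp(H\<^sub>2)\<close>, which is even, both are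
  trivial. With \<open>n = exp(H)\<close>, either \<open>2 ord(h)\<close> divides \<open>n\<close>, which already makes the power
  trivial, or \<open>g h g\<inverse> = h\<^sup>l\<close> with \<open>l\<close> odd, so that \<open>b = a\<^sup>l = a\<close> and \<open>a b = 1\<close>.\<close>

section \<open>Powers of lifts in a central extension\<close>

text \<open>For \<open>x\<close> with trivial \<open>n\<close>-th power this represents, modulo
  \<open>n\<close>-th powers in \<open>A\<close>, the image of \<open>f\<close> under the standard
  isomorphism from the second cohomology of a cyclic group of order \<open>n\<close> to
  \<open>A\<close> modulo \<open>n\<close>-th powers, after pulling \<open>f\<close> back along the
  map onto the powers of \<open>x\<close>.\<close>

definition cocycle_power ::
  "('a, 'm) monoid_scheme \<Rightarrow> ('c, 'n) monoid_scheme \<Rightarrow> ('a \<times> 'a \<Rightarrow> 'c) \<Rightarrow> 'a \<Rightarrow> nat \<Rightarrow> 'c"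
  where "cocycle_power G A f x n = (\<Otimes>\<^bsub>A\<^esub>i\<in>{..<n}. f (x [^]\<^bsub>G\<^esub> i, x))"

lemma cocycle_power_subgroup:
  "cocycle_power (G\<lparr>carrier := H\<rparr>) A f x n = cocycle_power G A f x n"
  by (simp add: cocycle_power_def nat_pow_def)

context
  fixes G :: "('a, 'm) monoid_scheme" and A :: "('c, 'n) monoid_scheme"
  assumes G: "group G" and A: "comm_group A"
begin

interpretation G: group G by (rule G)
interpretation A: comm_group A by (rule A)

lemma cocycle_power_closed:
  assumes "f \<in> Z2 G A" "x \<in> carrier G"
  shows "cocycle_power G A f x n \<in> carrier A"
  unfolding cocycle_power_def using assms by (auto intro!: A.finprod_closed Z2_closed[of f])

lemma cocycle_power_0: "cocycle_power G A f x 0 = \<one>\<^bsub>A\<^esub>"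
  by (simp add: cocycle_power_def)

lemma cocycle_power_Suc:
  assumes "f \<in> Z2 G A" "x \<in> carrier G"
  shows "cocycle_power G A f x (Suc n)
    = cocycle_power G A f x n \<otimes>\<^bsub>A\<^esub> f (x [^]\<^bsub>G\<^esub> n, x)"
proof -
  have "f (x [^]\<^bsub>G\<^esub> i, x) \<in> carrier A" for i :: nat
    using assms by (simp add: Z2_closed)
  then show ?thesis
    by (simp add: cocycle_power_def lessThan_Suc A.m_comm A.finprod_closed Pi_iff)
qed

text \<open>If \<open>f'\<close> is \<open>f\<close> times the coboundary of \<open>u\<close>, then
  the quotients of \<open>u\<close> at consecutive powers of \<open>x\<close> telescope to the
  quotient of \<open>u \<one>\<close> by \<open>u\<close> at the \<open>n\<close>-th power of
  \<open>x\<close>, which is trivial. What remains is the \<open>n\<close>-th power of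
  \<open>u x\<close>, and \<open>n\<close> annihilates \<open>A\<close>.\<close>

lemma cocycle_power_cohomologous:
  assumes f: "f \<in> Z2 G A" and f': "f' \<in> cohomology_class G A f" and x: "x \<in> carrier G"
    and xn: "x [^]\<^bsub>G\<^esub> n = \<one>\<^bsub>G\<^esub>" and An: "\<And>a. a \<in> carrier A \<Longrightarrow> a [^]\<^bsub>A\<^esub> n = \<one>\<^bsub>A\<^esub>"
  shows "cocycle_power G A f' x n = cocycle_power G A f x n"
proof -
  obtain u where f'Z: "f' \<in> Z2 G A" and u: "u \<in> carrier G \<rightarrow> carrier A"
    and fu: "\<And>x y. x \<in> carrier G \<Longrightarrow> y \<in> carrier G \<Longrightarrow>
      f' (x, y) \<otimes>\<^bsub>A\<^esub> u (x \<otimes>\<^bsub>G\<^esub> y) = f (x, y) \<otimes>\<^bsub>A\<^esub> u x \<otimes>\<^bsub>A\<^esub> u y"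
    using cohomology_class_memD[OF G A f f'] by blast
  have ucl: "u v \<in> carrier A" if "v \<in> carrier G" for v using u that by auto
  have "cocycle_power G A f' x k \<otimes>\<^bsub>A\<^esub> u (x [^]\<^bsub>G\<^esub> k)
      = cocycle_power G A f x k \<otimes>\<^bsub>A\<^esub> u x [^]\<^bsub>A\<^esub> k \<otimes>\<^bsub>A\<^esub> u \<one>\<^bsub>G\<^esub>" for k
  proof (induction k)
    case 0
    then show ?case using ucl by (simp add: cocycle_power_0)
  next
    case (Suc k)
    have cl: "cocycle_power G A f' x k \<in> carrier A" "cocycle_power G A f x k \<in> carrier A"
      "f' (x [^]\<^bsub>G\<^esub> k, x) \<in> carrier A" "f (x [^]\<^bsub>G\<^esub> k, x) \<in> carrier A"
      "u x \<in> carrier A" "u \<one>\<^bsub>G\<^esub> \<in> carrier A" "u (x [^]\<^bsub>G\<^esub> k) \<in> carrier A"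
      "u (x [^]\<^bsub>G\<^esub> k \<otimes>\<^bsub>G\<^esub> x) \<in> carrier A"
      using f f'Z x by (simp_all add: cocycle_power_closed Z2_closed ucl)
    have "cocycle_power G A f' x (Suc k) \<otimes>\<^bsub>A\<^esub> u (x [^]\<^bsub>G\<^esub> Suc k)
        = cocycle_power G A f' x k \<otimes>\<^bsub>A\<^esub> (f' (x [^]\<^bsub>G\<^esub> k, x) \<otimes>\<^bsub>A\<^esub> u (x [^]\<^bsub>G\<^esub> k \<otimes>\<^bsub>G\<^esub> x))"
      using cl by (simp add: cocycle_power_Suc f'Z x A.m_assoc)
    also have "\<dots> = (cocycle_power G A f' x k \<otimes>\<^bsub>A\<^esub> u (x [^]\<^bsub>G\<^esub> k)) \<otimes>\<^bsub>A\<^esub> (f (x [^]\<^bsub>G\<^esub> k, x) \<otimes>\<^bsub>A\<^esub> u x)"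
      using cl x by (simp add: fu A.m_ac)
    also have "\<dots> = cocycle_power G A f x (Suc k) \<otimes>\<^bsub>A\<^esub> u x [^]\<^bsub>A\<^esub> Suc k \<otimes>\<^bsub>A\<^esub> u \<one>\<^bsub>G\<^esub>"
      unfolding Suc.IH using cl by (simp add: cocycle_power_Suc f x A.m_ac)
    finally show ?case .
  qed
  from this[of n] show ?thesis
    using f f'Z x xn An ucl by (simp add: cocycle_power_closed)
qed

text \<open>This is where cochains not being normalized matters: the factor \<open>f (\<one>, x)\<close> of the
  product accounts for \<open>s \<one> = \<iota> (f (\<one>, \<one>))\<close>.\<close>

lemma section_pow:
  assumes ext: "central_extension A \<iota> E \<pi> G"
    and s: "\<And>x. x \<in> carrier G \<Longrightarrow> s x \<in> carrier E \<and> \<pi> (s x) = x"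
    and x: "x \<in> carrier G" and xn: "x [^]\<^bsub>G\<^esub> n = \<one>\<^bsub>G\<^esub>"
  shows "s x [^]\<^bsub>E\<^esub> n = \<iota> (cocycle_power G A (section_cocycle A \<iota> E G s) x n)"
proof -
  interpret E: group E using ext by (simp add: central_extension_def)
  let ?f = "section_cocycle A \<iota> E G s"
  have f: "?f \<in> Z2 G A" by (rule section_cocycle_Z2[OF G A ext s])
  have ss: "s x \<otimes>\<^bsub>E\<^esub> s y = \<iota> (?f (x, y)) \<otimes>\<^bsub>E\<^esub> s (x \<otimes>\<^bsub>G\<^esub> y)"
    if "x \<in> carrier G" "y \<in> carrier G" for x y
    using section_cocycle(2)[OF G A ext s that] .
  have io: "\<iota> \<in> hom A E" using ext by (simp add: central_extension_def mon_def)
  have io_cl: "\<iota> a \<in> carrier E" if "a \<in> carrier A" for a using io that by (auto simp: hom_def)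
  have scl: "s y \<in> carrier E" if "y \<in> carrier G" for y using s[OF that] by simp
  have "s \<one>\<^bsub>G\<^esub> \<otimes>\<^bsub>E\<^esub> s x [^]\<^bsub>E\<^esub> k = \<iota> (cocycle_power G A ?f x k) \<otimes>\<^bsub>E\<^esub> s (x [^]\<^bsub>G\<^esub> k)" for k
  proof (induction k)
    case 0
    have "\<iota> \<one>\<^bsub>A\<^esub> = \<one>\<^bsub>E\<^esub>" by (rule hom_one[OF io A.is_group E.is_group])
    then show ?case using scl by (simp add: cocycle_power_0)
  next
    case (Suc k)
    have cl: "\<iota> (cocycle_power G A ?f x k) \<in> carrier E" "\<iota> (?f (x [^]\<^bsub>G\<^esub> k, x)) \<in> carrier E"
      using f x by (auto intro!: io_cl cocycle_power_closed Z2_closed[of ?f])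
    have "s \<one>\<^bsub>G\<^esub> \<otimes>\<^bsub>E\<^esub> s x [^]\<^bsub>E\<^esub> Suc k = (s \<one>\<^bsub>G\<^esub> \<otimes>\<^bsub>E\<^esub> s x [^]\<^bsub>E\<^esub> k) \<otimes>\<^bsub>E\<^esub> s x"
      using scl x by (simp add: E.m_assoc)
    also have "\<dots> = \<iota> (cocycle_power G A ?f x k) \<otimes>\<^bsub>E\<^esub> (s (x [^]\<^bsub>G\<^esub> k) \<otimes>\<^bsub>E\<^esub> s x)"
      unfolding Suc.IH using scl x cl by (simp add: E.m_assoc)
    also have "\<dots> = \<iota> (cocycle_power G A ?f x (Suc k)) \<otimes>\<^bsub>E\<^esub> s (x [^]\<^bsub>G\<^esub> Suc k)"
      using scl x cl f
      by (simp add: ss cocycle_power_Suc hom_mult[OF io] cocycle_power_closed Z2_closed E.m_assoc)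
    finally show ?case .
  qed
  from this[of n] have "s \<one>\<^bsub>G\<^esub> \<otimes>\<^bsub>E\<^esub> s x [^]\<^bsub>E\<^esub> n = \<iota> (cocycle_power G A ?f x n) \<otimes>\<^bsub>E\<^esub> s \<one>\<^bsub>G\<^esub>"
    by (simp add: xn)
  also have "s \<one>\<^bsub>G\<^esub> = \<iota> (?f (\<one>\<^bsub>G\<^esub>, \<one>\<^bsub>G\<^esub>))"
    using ss[of "\<one>\<^bsub>G\<^esub>" "\<one>\<^bsub>G\<^esub>"] scl io_cl f by (simp add: Z2_closed)
  also have "\<iota> (cocycle_power G A ?f x n) \<otimes>\<^bsub>E\<^esub> \<iota> (?f (\<one>\<^bsub>G\<^esub>, \<one>\<^bsub>G\<^esub>))
      = \<iota> (?f (\<one>\<^bsub>G\<^esub>, \<one>\<^bsub>G\<^esub>)) \<otimes>\<^bsub>E\<^esub> \<iota> (cocycle_power G A ?f x n)"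
    using f x A.m_comm by (simp flip: hom_mult[OF io] add: cocycle_power_closed Z2_closed)
  finally show ?thesis
    using f x scl io_cl by (simp add: cocycle_power_closed Z2_closed)
qed

text \<open>The hypothesis relates \<open>f\<close> to the extension only through its class.
  Coboundaries do not affect \<open>cocycle_power\<close> under the two conditions on
  \<open>n\<close>, so \<open>f\<close> can be exchanged for the cocycle of any convenient
  section.\<close>

lemma extension_pow:
  assumes f: "cocycle_of_extension f A \<iota> E \<pi> G"
    and e: "e \<in> carrier E" and xn: "\<pi> e [^]\<^bsub>G\<^esub> n = \<one>\<^bsub>G\<^esub>"
    and An: "\<And>a. a \<in> carrier A \<Longrightarrow> a [^]\<^bsub>A\<^esub> n = \<one>\<^bsub>A\<^esub>"
  shows "e [^]\<^bsub>E\<^esub> n = \<iota> (cocycle_power G A f (\<pi> e) n)"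
proof -
  have fZ: "f \<in> Z2 G A" and ext: "central_extension A \<iota> E \<pi> G"
    and cls: "cohomology_class G A f = extension_class A \<iota> E \<pi> G"
    using f by (auto simp: cocycle_of_extension_def)
  have im: "\<pi> ` carrier E = carrier G" using ext by (simp add: central_extension_def epi_def)
  then have x: "\<pi> e \<in> carrier G" using e by auto
  \<comment> \<open>A section through \<open>e\<close> itself, so that \<open>section_pow\<close> applies to \<open>e\<close>.\<close>
  define s where "s = (inv_into (carrier E) \<pi>)(\<pi> e := e)"
  have s: "s y \<in> carrier E \<and> \<pi> (s y) = y" if "y \<in> carrier G" for y
    using that im e unfolding s_def by (auto simp: inv_into_into f_inv_into_f)
  have "f \<in> cohomology_class G A (section_cocycle A \<iota> E G s)"
    using cohomology_class_self[OF G A fZ] cls extension_class_eq[OF G A ext s] by simp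
  then have "cocycle_power G A f (\<pi> e) n = cocycle_power G A (section_cocycle A \<iota> E G s) (\<pi> e) n"
    using cocycle_power_cohomologous[OF section_cocycle_Z2[OF G A ext s] _ x xn An] by blast
  moreover have "s (\<pi> e) = e" by (simp add: s_def)
  ultimately show ?thesis
    using section_pow[OF ext s x xn] by simp
qed

end

section \<open>Corestriction from a subgroup of index two\<close>

context
  fixes G :: "('a, 'm) monoid_scheme" and H :: "'a set" and g :: 'a
  assumes G: "group G" and H: "subgroup H G" and ix: "card (rcosets\<^bsub>G\<^esub> H) = 2"
    and g: "g \<in> carrier G" "g \<notin> H"
begin

interpretation G: group G by (rule G)
interpretation H: subgroup H G by (rule H)

private lemma rcos_neq: "k \<in> carrier G \<Longrightarrow> k \<notin> H \<Longrightarrow> H #>\<^bsub>G\<^esub> k \<noteq> H"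
  using G.coset_join1[OF _ _ H] by auto

lemma rcosets_index_2: "rcosets\<^bsub>G\<^esub> H = {H, H #>\<^bsub>G\<^esub> g}"
proof (rule card_subset_eq[symmetric])
  show "finite (rcosets\<^bsub>G\<^esub> H)" using ix by (simp add: card_ge_0_finite)
  show "{H, H #>\<^bsub>G\<^esub> g} \<subseteq> rcosets\<^bsub>G\<^esub> H"
    using H.subgroup_in_rcosets[OF G] g G.rcosetsI[OF H.subset] by auto
  show "card {H, H #>\<^bsub>G\<^esub> g} = card (rcosets\<^bsub>G\<^esub> H)" using ix rcos_neq[OF g] by auto
qed

text \<open>Since \<open>g\<close> is outside \<open>H\<close>, so is its product with
  \<open>x\<close>, and there is only one coset other than \<open>H\<close>. In effect this is
  normality of \<open>H\<close>.\<close>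

lemma rcos_mult_index_2:
  assumes x: "x \<in> H"
  shows "H #>\<^bsub>G\<^esub> (g \<otimes>\<^bsub>G\<^esub> x) = H #>\<^bsub>G\<^esub> g"
proof -
  have "g = (g \<otimes>\<^bsub>G\<^esub> x) \<otimes>\<^bsub>G\<^esub> inv\<^bsub>G\<^esub> x"
    using g x by (simp add: G.m_assoc)
  then have "g \<otimes>\<^bsub>G\<^esub> x \<notin> H" using g x by (metis H.m_closed H.m_inv_closed)
  then have "H #>\<^bsub>G\<^esub> (g \<otimes>\<^bsub>G\<^esub> x) \<noteq> H" using rcos_neq g x by simp
  moreover have "H #>\<^bsub>G\<^esub> (g \<otimes>\<^bsub>G\<^esub> x) \<in> rcosets\<^bsub>G\<^esub> H"
    using g x G.rcosetsI[OF H.subset] by simp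
  ultimately show ?thesis unfolding rcosets_index_2 by auto
qed

lemma conjugate_index_2:
  assumes x: "x \<in> H"
  shows "g \<otimes>\<^bsub>G\<^esub> x \<otimes>\<^bsub>G\<^esub> inv\<^bsub>G\<^esub> g \<in> H"
proof -
  have "g \<otimes>\<^bsub>G\<^esub> x \<in> H #>\<^bsub>G\<^esub> g"
    using rcos_mult_index_2[OF x] G.rcos_self[of "g \<otimes>\<^bsub>G\<^esub> x", OF _ H] g x by auto
  then obtain h where "h \<in> H" "g \<otimes>\<^bsub>G\<^esub> x = h \<otimes>\<^bsub>G\<^esub> g" by (auto simp: r_coset_def)
  then show ?thesis using g by (simp add: G.m_assoc)
qed

text \<open>With these representatives the coset factors of an element of \<open>H\<close> are the
  element itself and its conjugate by \<open>g\<close>, without correction terms.\<close>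

lemma transversal_index_2: "transversal G H (\<lambda>C. if C = H then \<one>\<^bsub>G\<^esub> else g)"
  unfolding transversal_def rcosets_index_2 using rcos_neq[OF g] G.rcos_self[OF g(1) H] by auto

text \<open>Right multiplication by elements of \<open>H\<close> fixes both cosets, so each factor
  of the product involves only one representative. This is the double coset formula for restriction
  after corestriction, valid here already on cochains.\<close>

lemma corestriction_cochain_index_2:
  assumes A: "comm_group A" and f: "f \<in> Z2 (G\<lparr>carrier := H\<rparr>) A" and x: "x \<in> H" and y: "y \<in> H"
  shows "corestriction_cochain G A H (\<lambda>C. if C = H then \<one>\<^bsub>G\<^esub> else g) f (x, y)
    = f (x, y) \<otimes>\<^bsub>A\<^esub> f (g \<otimes>\<^bsub>G\<^esub> x \<otimes>\<^bsub>G\<^esub> inv\<^bsub>G\<^esub> g, g \<otimes>\<^bsub>G\<^esub> y \<otimes>\<^bsub>G\<^esub> inv\<^bsub>G\<^esub> g)"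
proof -
  interpret A: comm_group A by (rule A)
  let ?t = "\<lambda>C. if C = H then \<one>\<^bsub>G\<^esub> else g"
  have 1: "coset_factor G H ?t H z = z" if "z \<in> H" for z
    using that by (simp add: coset_factor_def H.rcos_const[OF G])
  have 2: "coset_factor G H ?t (H #>\<^bsub>G\<^esub> g) z = g \<otimes>\<^bsub>G\<^esub> z \<otimes>\<^bsub>G\<^esub> inv\<^bsub>G\<^esub> g" if "z \<in> H" for z
    using that g rcos_neq[OF g] rcos_mult_index_2[OF that] H.subset
    by (simp add: coset_factor_def G.coset_mult_assoc)
  have 3: "H #>\<^bsub>G\<^esub> g #>\<^bsub>G\<^esub> x = H #>\<^bsub>G\<^esub> g"
    using g x rcos_mult_index_2[OF x] H.subset by (simp add: G.coset_mult_assoc)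
  show ?thesis
    using x y rcos_neq[OF g, symmetric] conjugate_index_2[OF x] conjugate_index_2[OF y]
      Z2_closed[OF f]
    by (simp add: corestriction_cochain_def rcosets_index_2 1 2 3 H.rcos_const[OF G])
qed

lemma conjugate_pow:
  assumes "x \<in> carrier G"
  shows "(g \<otimes>\<^bsub>G\<^esub> x \<otimes>\<^bsub>G\<^esub> inv\<^bsub>G\<^esub> g) [^]\<^bsub>G\<^esub> (n::nat) = g \<otimes>\<^bsub>G\<^esub> x [^]\<^bsub>G\<^esub> n \<otimes>\<^bsub>G\<^esub> inv\<^bsub>G\<^esub> g"
proof (induction n)
  case (Suc n)
  have "inv\<^bsub>G\<^esub> g \<otimes>\<^bsub>G\<^esub> (g \<otimes>\<^bsub>G\<^esub> z) = z" if "z \<in> carrier G" for z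
    using that g by (simp flip: G.m_assoc)
  then show ?case using Suc assms g by (simp add: G.m_assoc)
qed (use g in simp)

text \<open>Conjugation commutes with powers, so the conjugated factors again form a
  \<open>cocycle_power\<close>, now at the conjugate of \<open>x\<close>.\<close>

lemma cocycle_power_corestriction_index_2:
  assumes A: "comm_group A" and f: "f \<in> Z2 (G\<lparr>carrier := H\<rparr>) A" and x: "x \<in> H"
  shows "cocycle_power G A (corestriction_cochain G A H (\<lambda>C. if C = H then \<one>\<^bsub>G\<^esub> else g) f) x n
    = cocycle_power G A f x n \<otimes>\<^bsub>A\<^esub> cocycle_power G A f (g \<otimes>\<^bsub>G\<^esub> x \<otimes>\<^bsub>G\<^esub> inv\<^bsub>G\<^esub> g) n"
proof -
  interpret A: comm_group A by (rule A)
  let ?y = "g \<otimes>\<^bsub>G\<^esub> x \<otimes>\<^bsub>G\<^esub> inv\<^bsub>G\<^esub> g"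
  have pow: "z [^]\<^bsub>G\<^esub> (i::nat) \<in> H" if "z \<in> H" for z i
    using that by (induction i) auto
  have cl: "f (z [^]\<^bsub>G\<^esub> (i::nat), z) \<in> carrier A" if "z \<in> H" for z i
    using Z2_closed[OF f] pow that by simp
  note y = conjugate_index_2[OF x]
  have "corestriction_cochain G A H (\<lambda>C. if C = H then \<one>\<^bsub>G\<^esub> else g) f (x [^]\<^bsub>G\<^esub> (i::nat), x)
      = f (x [^]\<^bsub>G\<^esub> i, x) \<otimes>\<^bsub>A\<^esub> f (?y [^]\<^bsub>G\<^esub> i, ?y)" for i
    using x by (simp add: corestriction_cochain_index_2[OF A f] pow conjugate_pow)
  then show ?thesis
    unfolding cocycle_power_def using cl[OF x] cl[OF y] by (simp add: A.finprod_multf)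
qed

text \<open>The number \<open>n\<close> and the lifts \<open>y\<close> and \<open>z\<close> are left
  free because the two claims use them differently: the first takes the exponent of
  \<open>H2\<close> and arbitrary lifts, the second the exponent of \<open>H\<close> and a power of
  \<open>y\<close> as \<open>z\<close>.\<close>

lemma corestriction_extension_pow:
  assumes A: "comm_group A"
    and fbar: "cocycle_of_extension fbar A \<kappa> H2 \<beta> (G\<lparr>carrier := H\<rparr>)"
    and f: "cocycle_of_extension f A \<iota> G1 \<alpha> G"
    and cls: "cohomology_class G A f
      = corestriction G A H (cohomology_class (G\<lparr>carrier := H\<rparr>) A fbar)"
    and x: "x \<in> carrier G1" "\<alpha> x \<in> H" and y: "y \<in> carrier H2" "\<beta> y = \<alpha> x"
    and z: "z \<in> carrier H2" "\<beta> z = g \<otimes>\<^bsub>G\<^esub> \<alpha> x \<otimes>\<^bsub>G\<^esub> inv\<^bsub>G\<^esub> g"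
    and xn: "\<alpha> x [^]\<^bsub>G\<^esub> (n::nat) = \<one>\<^bsub>G\<^esub>" and An: "\<And>a. a \<in> carrier A \<Longrightarrow> a [^]\<^bsub>A\<^esub> n = \<one>\<^bsub>A\<^esub>"
  obtains a b where "a \<in> carrier A" "b \<in> carrier A"
    "y [^]\<^bsub>H2\<^esub> n = \<kappa> a" "z [^]\<^bsub>H2\<^esub> n = \<kappa> b" "x [^]\<^bsub>G1\<^esub> n = \<iota> (a \<otimes>\<^bsub>A\<^esub> b)"
proof
  let ?K = "G\<lparr>carrier := H\<rparr>" and ?t = "\<lambda>C. if C = H then \<one>\<^bsub>G\<^esub> else g"
  have K: "group ?K" by (rule G.subgroup_imp_group[OF H])
  have fbZ: "fbar \<in> Z2 ?K A" and fZ: "f \<in> Z2 G A"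
    using fbar f by (auto simp: cocycle_of_extension_def)
  have fin: "finite (rcosets\<^bsub>G\<^esub> H)" using ix by (simp add: card_ge_0_finite)
  note t = transversal_index_2
  have hG: "\<alpha> x \<in> carrier G" using x by simp
  \<comment> \<open>\<open>corestriction\<close> is defined by an arbitrary transversal;
    \<open>corestriction_class\<close> allows the one adapted to \<open>g\<close> instead.\<close>
  have "f \<in> cohomology_class G A (corestriction_cochain G A H ?t fbar)"
    using cohomology_class_self[OF G A fZ] cls corestriction_class[OF G A H fin t fbZ] by simp
  then have "cocycle_power G A f (\<alpha> x) n
      = cocycle_power G A (corestriction_cochain G A H ?t fbar) (\<alpha> x) n"
    using cocycle_power_cohomologous[OF G A corestriction_cochain_Z2[OF G A H fin t fbZ] _ hG xn An]
    by blast
  then show "x [^]\<^bsub>G1\<^esub> n = \<iota> (cocycle_power G A fbar (\<alpha> x) n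
      \<otimes>\<^bsub>A\<^esub> cocycle_power G A fbar (g \<otimes>\<^bsub>G\<^esub> \<alpha> x \<otimes>\<^bsub>G\<^esub> inv\<^bsub>G\<^esub> g) n)"
    using extension_pow[OF G A f x(1) xn An]
      cocycle_power_corestriction_index_2[OF A fbZ x(2)] by simp
  have "\<beta> y [^]\<^bsub>?K\<^esub> n = \<one>\<^bsub>?K\<^esub>" "\<beta> z [^]\<^bsub>?K\<^esub> n = \<one>\<^bsub>?K\<^esub>"
    using xn hG g by (simp_all add: y z conjugate_pow flip: G.nat_pow_consistent)
  then show "y [^]\<^bsub>H2\<^esub> n = \<kappa> (cocycle_power G A fbar (\<alpha> x) n)"
    "z [^]\<^bsub>H2\<^esub> n = \<kappa> (cocycle_power G A fbar (g \<otimes>\<^bsub>G\<^esub> \<alpha> x \<otimes>\<^bsub>G\<^esub> inv\<^bsub>G\<^esub> g) n)"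
    using extension_pow[OF K A fbar y(1) _ An] extension_pow[OF K A fbar z(1) _ An]
    by (simp_all add: y z cocycle_power_subgroup)
  show "cocycle_power G A fbar (\<alpha> x) n \<in> carrier A"
    "cocycle_power G A fbar (g \<otimes>\<^bsub>G\<^esub> \<alpha> x \<otimes>\<^bsub>G\<^esub> inv\<^bsub>G\<^esub> g) n \<in> carrier A"
    using cocycle_power_closed[OF K A fbZ] x(2) conjugate_index_2[OF x(2)]
    by (simp_all add: cocycle_power_subgroup)
qed

end

section \<open>Exponents and divisibility\<close>

text \<open>The default values fit: an element of infinite order has \<open>ord\<close> 0, an
  infinite set of orders has \<open>LCM\<close> 0, and 0 divides only 0. Exponents are therefore
  compared by divisibility below.\<close>

lemma group_exponent_dvd_iff:
  assumes "group G"
  shows "group_exponent G dvd n \<longleftrightarrow> (\<forall>x\<in>carrier G. x [^]\<^bsub>G\<^esub> n = \<one>\<^bsub>G\<^esub>)"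
  using group.pow_eq_id[OF assms] by (auto simp: group_exponent_def Lcm_dvd_iff)

text \<open>Raising \<open>e\<close> to the order of \<open>G\<close> lands in the image of
  \<open>A\<close>, where the order of \<open>A\<close> finishes. This serves to exclude exponent 0
  for \<open>H2\<close>.\<close>

lemma central_extension_pow_order:
  assumes G: "group G" and A: "group A" and ext: "central_extension A \<iota> E \<pi> G"
    and e: "e \<in> carrier E"
  shows "e [^]\<^bsub>E\<^esub> (order G * order A) = \<one>\<^bsub>E\<^esub>"
proof -
  interpret E: group E using ext by (simp add: central_extension_def)
  interpret io: group_hom A E \<iota>
    using ext A E.group_axioms
    by (auto simp: central_extension_def mon_def group_hom_def group_hom_axioms_def)
  interpret pi: group_hom E G \<pi>
    using ext G E.group_axioms
    by (auto simp: central_extension_def epi_def group_hom_def group_hom_axioms_def)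
  have "e [^]\<^bsub>E\<^esub> order G \<in> kernel E G \<pi>"
    using e group.pow_order_eq_1[OF G] by (simp add: kernel_def pi.hom_nat_pow)
  then obtain a where a: "a \<in> carrier A" "e [^]\<^bsub>E\<^esub> order G = \<iota> a"
    using ext unfolding central_extension_def by (metis imageE)
  have "e [^]\<^bsub>E\<^esub> (order G * order A) = \<iota> (a [^]\<^bsub>A\<^esub> order A)"
    using e a by (simp add: io.hom_nat_pow flip: E.nat_pow_pow)
  then show ?thesis using a group.pow_order_eq_1[OF A] by simp
qed

text \<open>The divisibility holds because \<open>\<pi>\<close> maps \<open>P\<close> onto
  \<open>H\<close>, so whatever kills \<open>P\<close> kills \<open>H\<close>.\<close>

lemma group_exponent_preimage_dvd:
  assumes H: "subgroup H G" and hom: "group_hom E G \<pi>" and surj: "\<pi> ` carrier E = carrier G"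
    and P_def: "P = E\<lparr>carrier := {x \<in> carrier E. \<pi> x \<in> H}\<rparr>"
  shows "group P"
    and "group_exponent (G\<lparr>carrier := H\<rparr>) dvd group_exponent P"
proof -
  interpret pi: group_hom E G \<pi> by (rule hom)
  interpret H: subgroup H G by (rule H)
  have "subgroup {x \<in> carrier E. \<pi> x \<in> H} E"
    by (rule pi.G.subgroupI) (auto intro!: exI[of _ "\<one>\<^bsub>E\<^esub>"])
  then show P: "group P" unfolding P_def by (rule pi.G.subgroup_imp_group)
  have "h [^]\<^bsub>G\<^esub> group_exponent P = \<one>\<^bsub>G\<^esub>" if h: "h \<in> H" for h
  proof -
    obtain x where x: "x \<in> carrier E" "h = \<pi> x" using surj h by (metis H.mem_carrier imageE)
    have "x [^]\<^bsub>E\<^esub> group_exponent P = \<one>\<^bsub>E\<^esub>"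
      using group_exponent_dvd_iff[OF P, of "group_exponent P"] x h
      by (simp add: P_def flip: pi.G.nat_pow_consistent)
    then show ?thesis using x by (simp flip: pi.hom_nat_pow)
  qed
  then show "group_exponent (G\<lparr>carrier := H\<rparr>) dvd group_exponent P"
    by (simp add: group_exponent_dvd_iff[OF H.subgroup_is_group[OF pi.H.is_group]]
        flip: pi.H.nat_pow_consistent)
qed

text \<open>The second claim has to exclude trivial \<open>H\<close>: in that case \<open>H1\<close>
  is the image of \<open>mu2\<close> and has exponent 2, while \<open>H\<close> has exponent
  1.\<close>

theorem proposition4p4:
  fixes G :: "('a, 'm) monoid_scheme" and H :: "'a set" and g :: 'a
    and H2 :: "('b, 'p) monoid_scheme" and G1 :: "('c, 'q) monoid_scheme"
    and \<kappa> :: "int \<Rightarrow> 'b" and \<beta> :: "'b \<Rightarrow> 'a" and \<iota> :: "int \<Rightarrow> 'c" and \<alpha> :: "'c \<Rightarrow> 'a"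
    and fbar f :: "'a \<times> 'a \<Rightarrow> int"
  assumes "group G" and "finite (carrier G)" and "\<exists>n. order G = 2 ^ n"
    and "subgroup H G" and "card (rcosets\<^bsub>G\<^esub> H) = 2"
    and "g \<in> carrier G - H"
    and "cocycle_of_extension fbar mu2 \<kappa> H2 \<beta> (G\<lparr>carrier := H\<rparr>)"
    and "cocycle_of_extension f mu2 \<iota> G1 \<alpha> G"
    and "cohomology_class G mu2 f
      = corestriction G mu2 H (cohomology_class (G\<lparr>carrier := H\<rparr>) mu2 fbar)"
    and H1: "H1 = G1\<lparr>carrier := {x \<in> carrier G1. \<alpha> x \<in> H}\<rparr>"
  shows "group_exponent H1 \<le> group_exponent H2 \<and>
    (H \<noteq> {\<one>\<^bsub>G\<^esub>} \<longrightarrow>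
      (\<forall>h\<in>H. group.ord G h = group_exponent (G\<lparr>carrier := H\<rparr>) \<longrightarrow>
        g \<otimes>\<^bsub>G\<^esub> h \<otimes>\<^bsub>G\<^esub> inv\<^bsub>G\<^esub> g \<in> generate G {h}) \<longrightarrow>
      group_exponent H1 = group_exponent (G\<lparr>carrier := H\<rparr>))"
proof -
  let ?K = "G\<lparr>carrier := H\<rparr>"
  note fb = assms(7) and f = assms(8) and cls = assms(9)
  interpret G: group G by fact
  interpret H: subgroup H G by fact
  interpret mu: comm_group mu2 by (rule comm_group_mu2)
  have g: "g \<in> carrier G" "g \<notin> H" using assms(6) by auto
  have K: "group ?K" by (rule H.subgroup_is_group[OF G.is_group])
  have extH: "central_extension mu2 \<kappa> H2 \<beta> ?K" and extG: "central_extension mu2 \<iota> G1 \<alpha> G"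
    using fb f by (auto simp: cocycle_of_extension_def)
  interpret H2: group H2 using extH by (simp add: central_extension_def)
  interpret G1: group G1 using extG by (simp add: central_extension_def)
  interpret \<kappa>: group_hom mu2 H2 \<kappa>
    using extH by unfold_locales (auto simp: central_extension_def mon_def)
  interpret \<iota>: group_hom mu2 G1 \<iota>
    using extG by unfold_locales (auto simp: central_extension_def mon_def)
  interpret \<alpha>: group_hom G1 G \<alpha>
    using extG by unfold_locales (auto simp: central_extension_def epi_def)
  interpret \<beta>: group_hom H2 ?K \<beta>
    using extH K by (auto simp: central_extension_def epi_def group_hom_def group_hom_axioms_def)
  have \<kappa>_inj: "a = b" if "\<kappa> a = \<kappa> b" "a \<in> carrier mu2" "b \<in> carrier mu2" for a b
    using extH that by (auto simp: central_extension_def mon_def dest: inj_onD)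
  have \<beta>_surj: "\<exists>y\<in>carrier H2. \<beta> y = h" if "h \<in> H" for h
  proof -
    have "\<beta> ` carrier H2 = H" using extH by (simp add: central_extension_def epi_def)
    then show ?thesis using that by auto
  qed
  have \<alpha>_surj: "\<alpha> ` carrier G1 = carrier G"
    using extG by (simp add: central_extension_def epi_def)
  note H1_facts = group_exponent_preimage_dvd[OF assms(4) \<alpha>.group_hom_axioms \<alpha>_surj H1]
  have H1_dvd_iff: "group_exponent H1 dvd n \<longleftrightarrow>
      (\<forall>x\<in>carrier G1. \<alpha> x \<in> H \<longrightarrow> x [^]\<^bsub>G1\<^esub> n = \<one>\<^bsub>G1\<^esub>)" for n
    using group_exponent_dvd_iff[OF H1_facts(1)]
    by (auto simp: H1 simp flip: G1.nat_pow_consistent)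
  have K_dvd_iff: "group_exponent ?K dvd n \<longleftrightarrow> (\<forall>h\<in>H. h [^]\<^bsub>G\<^esub> n = \<one>\<^bsub>G\<^esub>)" for n
    using group_exponent_dvd_iff[OF K] by (auto simp flip: G.nat_pow_consistent)
  have "H \<noteq> {}" using H.one_closed by blast
  then have order_H: "order ?K > 0"
    using finite_subset[OF H.subset assms(2)] by (simp add: order_def card_gt_0_iff)
  note key = corestriction_extension_pow[OF G.is_group assms(4,5) g comm_group_mu2 fb f cls]
  have conjH: "g \<otimes>\<^bsub>G\<^esub> h \<otimes>\<^bsub>G\<^esub> inv\<^bsub>G\<^esub> g \<in> H" if "h \<in> H" for h
    by (rule conjugate_index_2[OF G.is_group assms(4,5) g that])
  have mu_sq: "a \<otimes>\<^bsub>mu2\<^esub> a = \<one>\<^bsub>mu2\<^esub>" if "a \<in> carrier mu2" for a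
    using that by (auto simp: mu2_def)
  have mu_even: "a [^]\<^bsub>mu2\<^esub> n = \<one>\<^bsub>mu2\<^esub>" if "a \<in> carrier mu2" "even n" for a and n :: nat
  proof -
    obtain m where "n = 2 * m" using \<open>even n\<close> ..
    moreover have "a [^]\<^bsub>mu2\<^esub> (2::nat) = \<one>\<^bsub>mu2\<^esub>"
      using that mu_sq by (simp add: numeral_2_eq_2)
    ultimately show ?thesis using that by (simp flip: mu.nat_pow_pow)
  qed

  \<comment> \<open>Comparison with the exponent of \<open>H2\<close>\<close>
  have "group_exponent H1 dvd group_exponent H2"
    unfolding H1_dvd_iff
  proof (intro ballI impI)
    let ?n = "group_exponent H2"
    have H2n: "y [^]\<^bsub>H2\<^esub> ?n = \<one>\<^bsub>H2\<^esub>" if "y \<in> carrier H2" for y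
      using group_exponent_dvd_iff[OF H2.is_group, of ?n] that by simp
    \<comment> \<open>As \<open>\<kappa>\<close> embeds \<open>mu2\<close> in \<open>H2\<close>, the
      exponent of \<open>H2\<close> kills \<open>mu2\<close> too.\<close>
    have An: "a [^]\<^bsub>mu2\<^esub> ?n = \<one>\<^bsub>mu2\<^esub>" if "a \<in> carrier mu2" for a
      using that H2n by (intro \<kappa>_inj) (simp_all add: \<kappa>.hom_nat_pow)
    fix x assume x: "x \<in> carrier G1" "\<alpha> x \<in> H"
    obtain y where y: "y \<in> carrier H2" "\<beta> y = \<alpha> x" using \<beta>_surj x by blast
    obtain z where z: "z \<in> carrier H2" "\<beta> z = g \<otimes>\<^bsub>G\<^esub> \<alpha> x \<otimes>\<^bsub>G\<^esub> inv\<^bsub>G\<^esub> g"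
      using \<beta>_surj conjH x by blast
    have "\<alpha> x [^]\<^bsub>G\<^esub> ?n = \<one>\<^bsub>G\<^esub>"
      using \<beta>.hom_nat_pow[OF y(1), of ?n] H2n[OF y(1)] y(2) \<beta>.hom_one
      by (simp flip: G.nat_pow_consistent)
    from key[OF x y z this An] obtain a b where ab: "a \<in> carrier mu2" "b \<in> carrier mu2"
      "y [^]\<^bsub>H2\<^esub> ?n = \<kappa> a" "z [^]\<^bsub>H2\<^esub> ?n = \<kappa> b" "x [^]\<^bsub>G1\<^esub> ?n = \<iota> (a \<otimes>\<^bsub>mu2\<^esub> b)"
      by blast
    have "a = \<one>\<^bsub>mu2\<^esub>" "b = \<one>\<^bsub>mu2\<^esub>" using ab H2n y z by (auto intro!: \<kappa>_inj)
    then show "x [^]\<^bsub>G1\<^esub> ?n = \<one>\<^bsub>G1\<^esub>" using ab(5) by simp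
  qed
  \<comment> \<open>Divisibility gives the inequality only once the value 0 is ruled out.\<close>
  moreover have "group_exponent H2 > 0"
  proof -
    have "group_exponent H2 dvd order ?K * order mu2"
      using central_extension_pow_order[OF K mu.is_group extH]
      by (simp add: group_exponent_dvd_iff[OF H2.is_group])
    moreover have "order mu2 > 0" by (simp add: order_def mu2_def)
    ultimately show ?thesis using order_H by (metis dvd_pos_nat nat_0_less_mult_iff)
  qed
  ultimately have part1: "group_exponent H1 \<le> group_exponent H2" by (rule dvd_imp_le)

  \<comment> \<open>Comparison with the exponent of \<open>H\<close>\<close>
  have part2: "group_exponent H1 = group_exponent ?K"
    if H_nontriv: "H \<noteq> {\<one>\<^bsub>G\<^esub>}"
      and conj: "\<forall>h\<in>H. group.ord G h = group_exponent ?K \<longrightarrow>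
        g \<otimes>\<^bsub>G\<^esub> h \<otimes>\<^bsub>G\<^esub> inv\<^bsub>G\<^esub> g \<in> generate G {h}"
  proof (rule dvd_antisym)
    define n where "n = group_exponent ?K"
    have Kn: "h [^]\<^bsub>G\<^esub> n = \<one>\<^bsub>G\<^esub>" if "h \<in> H" for h
      using that K_dvd_iff[of n] by (simp add: n_def)
    obtain k where k: "order G = 2 ^ k" using assms(3) ..
    have "n dvd 2 ^ k"
      unfolding n_def K_dvd_iff using G.pow_order_eq_1 by (simp flip: k)
    then obtain j where j: "n = 2 ^ j"
      by (metis divides_primepow_nat two_is_prime_nat)
    \<comment> \<open>Nontriviality of \<open>H\<close> enters here: \<open>n\<close> is a power of
      two other than 1, hence even, hence annihilates \<open>mu2\<close>.\<close>
    obtain h where h: "h \<in> H" "h \<noteq> \<one>\<^bsub>G\<^esub>"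
      using H_nontriv H.one_closed by blast
    have "n \<noteq> 1" using Kn[OF h(1)] h by auto
    then have even: "even n" using j by (cases j) auto
    have An: "a [^]\<^bsub>mu2\<^esub> n = \<one>\<^bsub>mu2\<^esub>" if "a \<in> carrier mu2" for a
      using mu_even[OF that even] .
    show "group_exponent ?K dvd group_exponent H1" by (rule H1_facts(2))
    have "x [^]\<^bsub>G1\<^esub> n = \<one>\<^bsub>G1\<^esub>" if x: "x \<in> carrier G1" "\<alpha> x \<in> H" for x
    proof (cases "G.ord (\<alpha> x) = n")
      case False
      have "G.ord (\<alpha> x) dvd n" using Kn x by (simp flip: G.pow_eq_id)
      then obtain i where i: "G.ord (\<alpha> x) = 2 ^ i" "i \<le> j"
        using j by (metis divides_primepow_nat two_is_prime_nat)
      \<comment> \<open>A proper divisor of a power of two leaves room for one more factor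
        2.\<close>
      then have "i < j" using False j by (cases "i = j") auto
      then have "2 ^ i * 2 dvd n" using le_imp_power_dvd[of "Suc i" j "2::nat"] j by (simp add: mult.commute)
      then obtain m where m: "n = 2 ^ i * 2 * m" ..
      \<comment> \<open>The order of \<open>\<alpha> x\<close> takes \<open>x\<close> into the image
        of \<open>mu2\<close>, and the spare factor 2 then kills it.\<close>
      have "x [^]\<^bsub>G1\<^esub> (2 ^ i :: nat) \<in> kernel G1 G \<alpha>"
        using x G.pow_ord_eq_1[of "\<alpha> x"] by (simp add: kernel_def \<alpha>.hom_nat_pow i)
      then obtain a where a: "a \<in> carrier mu2" "x [^]\<^bsub>G1\<^esub> (2 ^ i :: nat) = \<iota> a"
        using extG unfolding central_extension_def by (metis imageE)
      have "x [^]\<^bsub>G1\<^esub> (2 ^ i * 2 :: nat) = \<iota> (a [^]\<^bsub>mu2\<^esub> (2::nat))"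
        using a by (simp add: \<iota>.hom_nat_pow x flip: G1.nat_pow_pow)
      then have "x [^]\<^bsub>G1\<^esub> (2 ^ i * 2 :: nat) = \<one>\<^bsub>G1\<^esub>" using mu_even a by simp
      then show ?thesis unfolding m using x by (simp flip: G1.nat_pow_pow)
    next
      case True
      let ?h = "\<alpha> x" and ?h' = "g \<otimes>\<^bsub>G\<^esub> \<alpha> x \<otimes>\<^bsub>G\<^esub> inv\<^bsub>G\<^esub> g"
      have hG: "?h \<in> carrier G" using x by simp
      have "?h' \<in> generate G {?h}" using conj x True n_def by blast
      \<comment> \<open>In a finite group the exponent can be taken natural, which permits the
        parity argument with \<open>nat\<close> powers.\<close>
      then obtain l :: nat where l: "?h' = ?h [^]\<^bsub>G\<^esub> l"
        using G.generate_pow_on_finite_carrier[OF assms(2) hG] by auto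
      \<comment> \<open>If \<open>l\<close> were even, the power \<open>n div 2\<close> would kill
        the conjugate, since \<open>n\<close> kills \<open>?h\<close>. It would then kill
        \<open>?h\<close> as well, although \<open>?h\<close> has order \<open>n\<close>.\<close>
      have "odd l"
      proof
        assume "even l"
        then have "?h' [^]\<^bsub>G\<^esub> (n div 2) = ?h [^]\<^bsub>G\<^esub> (n * (l div 2))"
          using even hG by (auto simp: l G.nat_pow_pow ac_simps elim!: evenE)
        also have "\<dots> = \<one>\<^bsub>G\<^esub>" using Kn x by (simp flip: G.nat_pow_pow)
        finally have "g \<otimes>\<^bsub>G\<^esub> ?h [^]\<^bsub>G\<^esub> (n div 2) \<otimes>\<^bsub>G\<^esub> inv\<^bsub>G\<^esub> g = \<one>\<^bsub>G\<^esub>"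
          using conjugate_pow[OF G.is_group assms(4,5) g hG] by simp
        then have "?h [^]\<^bsub>G\<^esub> (n div 2) = \<one>\<^bsub>G\<^esub>"
          using g hG by (metis G.inv_closed G.inv_inv G.inv_equality G.m_closed G.nat_pow_closed
              G.r_cancel_one G.r_inv G.l_cancel_one)
        then have "n dvd n div 2" using True hG by (simp add: G.pow_eq_id)
        moreover have "0 < n div 2" "n div 2 < n" using even j by (cases j; simp)+
        ultimately show False by (simp add: nat_dvd_not_less)
      qed
      obtain y where y: "y \<in> carrier H2" "\<beta> y = ?h" using \<beta>_surj x by blast
      \<comment> \<open>Choosing this lift of the conjugate forces \<open>b\<close> to be the
        \<open>l\<close>-th power of \<open>a\<close>.\<close>
      have z: "y [^]\<^bsub>H2\<^esub> l \<in> carrier H2" "\<beta> (y [^]\<^bsub>H2\<^esub> l) = ?h'"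
        using y by (simp_all add: \<beta>.hom_nat_pow l flip: G.nat_pow_consistent)
      from key[OF x y z Kn[OF x(2)] An] obtain a b where ab: "a \<in> carrier mu2" "b \<in> carrier mu2"
        "y [^]\<^bsub>H2\<^esub> n = \<kappa> a" "(y [^]\<^bsub>H2\<^esub> l) [^]\<^bsub>H2\<^esub> n = \<kappa> b" "x [^]\<^bsub>G1\<^esub> n = \<iota> (a \<otimes>\<^bsub>mu2\<^esub> b)"
        by blast
      have "\<kappa> b = (y [^]\<^bsub>H2\<^esub> n) [^]\<^bsub>H2\<^esub> l"
        using y ab(4) by (simp add: H2.nat_pow_pow mult.commute)
      then have "b = a [^]\<^bsub>mu2\<^esub> l" using ab by (intro \<kappa>_inj) (simp_all add: \<kappa>.hom_nat_pow)
      \<comment> \<open>An odd power of a sign is the sign itself, so the product of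
        \<open>a\<close> and \<open>b\<close> is a square in \<open>mu2\<close>.\<close>
      then have "b = a" using \<open>odd l\<close> ab(1) mu_even by (auto elim!: oddE)
      then show ?thesis using ab mu_sq by simp
    qed
    then show "group_exponent H1 dvd group_exponent ?K"
      by (simp add: H1_dvd_iff flip: n_def)
  qed

  show ?thesis using part1 part2 by blast
qed

end
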